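(* There exist an algebraically closed field $k$, a reductive linear algebraic group $G$ over $k$, a reductive subgroup $M$ of $G$ and a pair $(m_1,m_2)\in M^2$ such that $(G,M)$ is a reductive pair but $G\cdot(m_1,m_2)\cap M^2$ is not a finite union of $M$-conjugacy classes.
   Context: "Subgroup" means closed subgroup; an algebraic group is reductive if its unipotent radical is trivial (not necessarily connected). $G$ acts on $G^2$ by simultaneous conjugation, $g\cdot(g_1,g_2)=(gg_1g^{-1},gg_2g^{-1})$; $G\cdot(m_1,m_2)$ is the $G$-orbit, and $M$-conjugacy classes are $M$-orbits for simultaneous conjugation of $M$ on $M^2$. For a reductive subgroup $M$ of a reductive group $G$, $(G,M)$ is a reductive pair if $\operatorname{Lie}M$ is an $M$-module direct summand of $\operatorname{Lie}G$, where $M$ acts on $\operatorname{Lie} G$ by the adjoint action. *)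

theory Defs
  imports
    "HOL-Algebra.Algebraic_Closure"
    "HOL-Algebra.Group_Action"
    "HOL-Analysis.Abstract_Topology"
    "Jordan_Normal_Form.Matrix"
begin

section \<open>Polynomials in several variables\<close>

text \<open>Polynomials are those of \<^theory>\<open>HOL-Algebra.Indexed_Polynomials\<close>: coefficient
  functions on monomials, a monomial being a multiset of variables.\<close>

definition monom_eval :: "('a, 'b) ring_scheme \<Rightarrow> 'c multiset \<Rightarrow> ('c \<Rightarrow> 'a) \<Rightarrow> 'a" where
  "monom_eval R m x = (\<Otimes>\<^bsub>R\<^esub>i\<in>set_mset m. x i [^]\<^bsub>R\<^esub> count m i)"

definition poly_eval :: "('a, 'b) ring_scheme \<Rightarrow> ('c multiset \<Rightarrow> 'a) \<Rightarrow> ('c \<Rightarrow> 'a) \<Rightarrow> 'a" where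
  "poly_eval R P x = (\<Oplus>\<^bsub>R\<^esub>m\<in>{m. P m \<noteq> \<zero>\<^bsub>R\<^esub>}. P m \<otimes>\<^bsub>R\<^esub> monom_eval R m x)"

text \<open>Formal partial derivative: the coefficient of \<open>m\<close> in \<open>\<partial>P/\<partial>x\<^sub>i\<close> is
  \<open>(d + 1)\<close> times the coefficient of \<open>m x\<^sub>i\<close> in \<open>P\<close>, where \<open>d\<close> is the degree of \<open>m\<close> in \<open>x\<^sub>i\<close>.\<close>

definition poly_deriv :: "('a, 'b) ring_scheme \<Rightarrow> 'c \<Rightarrow> ('c multiset \<Rightarrow> 'a) \<Rightarrow> 'c multiset \<Rightarrow> 'a" where
  "poly_deriv R i P = (\<lambda>m. [Suc (count m i)] \<cdot>\<^bsub>R\<^esub> P (add_mset i m))"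

context domain
begin

lemma monom_eval_closed [simp]:
  assumes "\<And>i. i \<in># m \<Longrightarrow> x i \<in> carrier R"
  shows "monom_eval R m x \<in> carrier R"
  unfolding monom_eval_def using assms by (intro finprod_closed) auto

lemma monom_eval_add_mset:
  assumes "\<And>j. j \<in># add_mset i m \<Longrightarrow> x j \<in> carrier R"
  shows "monom_eval R (add_mset i m) x = monom_eval R m x \<otimes> x i"
proof -
  let ?A = "set_mset m - {i}"
  have xi: "x i \<in> carrier R" using assms by simp
  have F: "(\<lambda>j. x j [^] count m j) \<in> ?A \<rightarrow> carrier R" using assms by auto
  have F': "(\<lambda>j. x j [^] count (add_mset i m) j) \<in> ?A \<rightarrow> carrier R" using assms by auto
  have eq: "(\<Otimes>j\<in>?A. x j [^] count (add_mset i m) j) = (\<Otimes>j\<in>?A. x j [^] count m j)"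
    using F by (intro finprod_cong') auto
  have P: "(\<Otimes>j\<in>?A. x j [^] count m j) \<in> carrier R"
    using F by (intro finprod_closed)
  have 1: "monom_eval R (add_mset i m) x
      = x i [^] Suc (count m i) \<otimes> (\<Otimes>j\<in>?A. x j [^] count m j)"
  proof -
    have "monom_eval R (add_mset i m) x = (\<Otimes>j\<in>insert i ?A. x j [^] count (add_mset i m) j)"
      unfolding monom_eval_def by (simp only: set_mset_add_mset_insert insert_Diff_single)
    also have "\<dots> = x i [^] count (add_mset i m) i \<otimes> (\<Otimes>j\<in>?A. x j [^] count (add_mset i m) j)"
      using F' xi by (intro finprod_insert) auto
    finally show ?thesis using eq by simp
  qed
  have 2: "monom_eval R m x = x i [^] count m i \<otimes> (\<Otimes>j\<in>?A. x j [^] count m j)"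
  proof (cases "i \<in># m")
    case True
    then have "monom_eval R m x = (\<Otimes>j\<in>insert i ?A. x j [^] count m j)"
      unfolding monom_eval_def by (simp add: insert_absorb)
    also have "\<dots> = x i [^] count m i \<otimes> (\<Otimes>j\<in>?A. x j [^] count m j)"
      using F xi by (intro finprod_insert) auto
    finally show ?thesis .
  next
    case False
    then have "?A = set_mset m" "count m i = 0" by (auto simp: count_eq_zero_iff)
    then show ?thesis using P by (simp add: monom_eval_def)
  qed
  show ?thesis unfolding 1 2 using xi P by (simp add: m_ac)
qed

lemma indexed_pset_support:
  assumes "P \<in> indexed_pset I (carrier R)"
  shows "finite {m. P m \<noteq> \<zero>} \<and> (\<forall>m. P m \<noteq> \<zero> \<longrightarrow> set_mset m \<subseteq> I) \<and> (\<forall>m. P m \<in> carrier R)"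
  using assms
proof (induction rule: indexed_pset.induct)
  case (indexed_const k)
  have "{m. indexed_const k m \<noteq> \<zero>} \<subseteq> {{#}}"
    by (auto simp: indexed_const_def)
  with indexed_const show ?case
    by (auto simp: indexed_const_def intro: finite_subset)
next
  case (indexed_padd P Q)
  have "{m. (P \<Oplus> Q) m \<noteq> \<zero>} \<subseteq> {m. P m \<noteq> \<zero>} \<union> {m. Q m \<noteq> \<zero>}"
    by (auto simp: indexed_padd_def)
  then have "finite {m. (P \<Oplus> Q) m \<noteq> \<zero>}"
    using indexed_padd by (meson finite_UnI finite_subset)
  moreover have "set_mset m \<subseteq> I" if "(P \<Oplus> Q) m \<noteq> \<zero>" for m
  proof -
    have "P m \<noteq> \<zero> \<or> Q m \<noteq> \<zero>" using that by (auto simp: indexed_padd_def)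
    then show ?thesis using indexed_padd by blast
  qed
  ultimately show ?case using indexed_padd by (auto simp: indexed_padd_def)
next
  case (indexed_pmult P i)
  have "{m. (P \<Otimes> i) m \<noteq> \<zero>} \<subseteq> add_mset i ` {m. P m \<noteq> \<zero>}"
  proof
    fix m assume "m \<in> {m. (P \<Otimes> i) m \<noteq> \<zero>}"
    then have "i \<in># m" "P (m - {#i#}) \<noteq> \<zero>" by (auto simp: indexed_pmult_def split: if_splits)
    then show "m \<in> add_mset i ` {m. P m \<noteq> \<zero>}"
      by (intro image_eqI[where x = "m - {#i#}"]) (simp_all only: mem_Collect_eq insert_DiffM not_False_eq_True)
  qed
  then have "finite {m. (P \<Otimes> i) m \<noteq> \<zero>}"
    using indexed_pmult by (meson finite_imageI finite_subset)
  moreover have "set_mset m \<subseteq> I" if "(P \<Otimes> i) m \<noteq> \<zero>" for m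
  proof -
    have "i \<in># m" "P (m - {#i#}) \<noteq> \<zero>"
      using that by (auto simp: indexed_pmult_def split: if_splits)
    then have "set_mset (m - {#i#}) \<subseteq> I" "m = add_mset i (m - {#i#})"
      using indexed_pmult by auto
    then show ?thesis
      by (metis \<open>i \<in> I\<close> insert_subset set_mset_add_mset_insert)
  qed
  ultimately show ?case using indexed_pmult by (auto simp: indexed_pmult_def)
qed

lemma poly_eval_superset:
  assumes "P \<in> indexed_pset I (carrier R)" and "\<And>i. i \<in> I \<Longrightarrow> x i \<in> carrier R"
    and "finite S" "{m. P m \<noteq> \<zero>} \<subseteq> S" "\<And>m. m \<in> S \<Longrightarrow> set_mset m \<subseteq> I"
  shows "poly_eval R P x = (\<Oplus>m\<in>S. P m \<otimes> monom_eval R m x)"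
proof -
  have c: "P m \<in> carrier R" for m using indexed_pset_support[OF assms(1)] by blast
  have mc: "monom_eval R m x \<in> carrier R" if "m \<in> S" for m
    using assms(2,5) that by (intro monom_eval_closed) blast
  show ?thesis
    unfolding poly_eval_def
    by (rule add.finprod_mono_neutral_cong_left) (use assms(3,4) c mc in auto)
qed

lemma poly_eval_closed:
  assumes "P \<in> indexed_pset I (carrier R)" and "\<And>i. i \<in> I \<Longrightarrow> x i \<in> carrier R"
  shows "poly_eval R P x \<in> carrier R"
proof -
  have s: "\<And>m. P m \<noteq> \<zero> \<Longrightarrow> set_mset m \<subseteq> I" "\<And>m. P m \<in> carrier R"
    using indexed_pset_support[OF assms(1)] by blast+
  have "monom_eval R m x \<in> carrier R" if "P m \<noteq> \<zero>" for m
    using assms(2) s(1)[OF that] by (intro monom_eval_closed) blast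
  then show ?thesis
    unfolding poly_eval_def using s(2) by (intro finsum_closed) auto
qed

lemma poly_eval_const:
  assumes "k \<in> carrier R"
  shows "poly_eval R (indexed_const k) x = k"
proof -
  have "indexed_const k \<in> indexed_pset {} (carrier R)"
    using assms by (rule indexed_pset.indexed_const)
  then have "poly_eval R (indexed_const k) x
      = (\<Oplus>m\<in>{{#}}. indexed_const k m \<otimes> monom_eval R m x)"
    by (rule poly_eval_superset) (auto simp: indexed_const_def split: if_splits)
  then show ?thesis using assms by (simp add: indexed_const_def monom_eval_def)
qed

lemma poly_eval_add:
  assumes P: "P \<in> indexed_pset I (carrier R)" and Q: "Q \<in> indexed_pset I (carrier R)"
    and x: "\<And>i. i \<in> I \<Longrightarrow> x i \<in> carrier R"
  shows "poly_eval R (P \<Oplus> Q) x = poly_eval R P x \<oplus> poly_eval R Q x"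
proof -
  let ?S = "{m. P m \<noteq> \<zero>} \<union> {m. Q m \<noteq> \<zero>}"
  note p = indexed_pset_support[OF P] and q = indexed_pset_support[OF Q]
  have S: "finite ?S" "\<And>m. m \<in> ?S \<Longrightarrow> set_mset m \<subseteq> I" using p q by auto
  have mc: "monom_eval R m x \<in> carrier R" if "m \<in> ?S" for m
    using x S(2)[OF that] by (intro monom_eval_closed) blast
  have PQ: "P \<Oplus> Q \<in> indexed_pset I (carrier R)" using P Q by (rule indexed_pset.indexed_padd)
  have "poly_eval R (P \<Oplus> Q) x = (\<Oplus>m\<in>?S. (P \<Oplus> Q) m \<otimes> monom_eval R m x)"
    by (rule poly_eval_superset[OF PQ x S(1) _ S(2)]) (auto simp: indexed_padd_def)
  also have "\<dots> = (\<Oplus>m\<in>?S. P m \<otimes> monom_eval R m x \<oplus> Q m \<otimes> monom_eval R m x)"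
    using p q mc by (intro finsum_cong') (auto simp: indexed_padd_def l_distr)
  also have "\<dots> = (\<Oplus>m\<in>?S. P m \<otimes> monom_eval R m x) \<oplus> (\<Oplus>m\<in>?S. Q m \<otimes> monom_eval R m x)"
    using p q mc by (intro finsum_addf) auto
  also have "(\<Oplus>m\<in>?S. P m \<otimes> monom_eval R m x) = poly_eval R P x"
    by (rule poly_eval_superset[OF P x S(1) _ S(2), symmetric]) auto
  also have "(\<Oplus>m\<in>?S. Q m \<otimes> monom_eval R m x) = poly_eval R Q x"
    by (rule poly_eval_superset[OF Q x S(1) _ S(2), symmetric]) auto
  finally show ?thesis .
qed

lemma poly_eval_mult_var:
  assumes P: "P \<in> indexed_pset I (carrier R)" and i: "i \<in> I"
    and x: "\<And>i. i \<in> I \<Longrightarrow> x i \<in> carrier R"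
  shows "poly_eval R (P \<Otimes> i) x = poly_eval R P x \<otimes> x i"
proof -
  let ?S = "{m. P m \<noteq> \<zero>}"
  note p = indexed_pset_support[OF P]
  have mc: "monom_eval R m x \<in> carrier R" if "m \<in> ?S" for m
    using x p that by (intro monom_eval_closed) blast
  have PX: "P \<Otimes> i \<in> indexed_pset I (carrier R)" using P i by (rule indexed_pset.indexed_pmult)
  have sub: "{m. (P \<Otimes> i) m \<noteq> \<zero>} \<subseteq> add_mset i ` ?S"
  proof
    fix m assume "m \<in> {m. (P \<Otimes> i) m \<noteq> \<zero>}"
    then have "i \<in># m" "P (m - {#i#}) \<noteq> \<zero>" by (auto simp: indexed_pmult_def split: if_splits)
    then show "m \<in> add_mset i ` ?S"
      by (intro image_eqI[where x = "m - {#i#}"]) (simp_all only: mem_Collect_eq insert_DiffM not_False_eq_True)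
  qed
  have step: "monom_eval R (add_mset i m) x = monom_eval R m x \<otimes> x i" if "m \<in> ?S" for m
    using x i p that by (intro monom_eval_add_mset) auto
  have "poly_eval R (P \<Otimes> i) x = (\<Oplus>m\<in>add_mset i ` ?S. (P \<Otimes> i) m \<otimes> monom_eval R m x)"
  proof (rule poly_eval_superset[OF PX x _ sub])
    show "finite (add_mset i ` ?S)" using p by simp
    show "set_mset m \<subseteq> I" if m: "m \<in> add_mset i ` ?S" for m
    proof -
      obtain m' where "m = add_mset i m'" "P m' \<noteq> \<zero>" using m by blast
      moreover have "set_mset m' \<subseteq> I" using p \<open>P m' \<noteq> \<zero>\<close> by blast
      ultimately show ?thesis using i by simp
    qed
  qed
  also have "\<dots> = (\<Oplus>m\<in>?S. (P \<Otimes> i) (add_mset i m) \<otimes> monom_eval R (add_mset i m) x)"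
    by (rule add.finprod_reindex)
       (use p mc step x i in \<open>auto simp: indexed_pmult_def inj_on_def\<close>)
  also have "\<dots> = (\<Oplus>m\<in>?S. (P m \<otimes> monom_eval R m x) \<otimes> x i)"
    by (rule finsum_cong') (use p mc step x i in \<open>auto simp: indexed_pmult_def m_assoc\<close>)
  also have "\<dots> = poly_eval R P x \<otimes> x i"
    unfolding poly_eval_def
    by (rule finsum_ldistr[symmetric]) (use p mc x i in auto)
  finally show ?thesis .
qed

lemma ex_poly_mult:
  assumes P: "P \<in> indexed_pset I (carrier R)" and Q: "Q \<in> indexed_pset I (carrier R)"
  shows "\<exists>S \<in> indexed_pset I (carrier R).
    \<forall>x. (\<forall>i\<in>I. x i \<in> carrier R) \<longrightarrow> poly_eval R S x = poly_eval R P x \<otimes> poly_eval R Q x"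
  using Q
proof (induction rule: indexed_pset.induct)
  case (indexed_const k)
  from P show ?case
  proof (induction rule: indexed_pset.induct)
    case (indexed_const l)
    then show ?case using \<open>k \<in> carrier R\<close>
      by (intro bexI[where x = "indexed_const (l \<otimes> k)"])
         (auto simp: poly_eval_const intro: indexed_pset.indexed_const)
  next
    case (indexed_padd A B)
    then obtain S T where "S \<in> indexed_pset I (carrier R)" "T \<in> indexed_pset I (carrier R)"
      "\<forall>x. (\<forall>i\<in>I. x i \<in> carrier R) \<longrightarrow>
        poly_eval R S x = poly_eval R A x \<otimes> poly_eval R (indexed_const k) x"
      "\<forall>x. (\<forall>i\<in>I. x i \<in> carrier R) \<longrightarrow>
        poly_eval R T x = poly_eval R B x \<otimes> poly_eval R (indexed_const k) x" by blast
    then show ?case using indexed_padd \<open>k \<in> carrier R\<close>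
      by (intro bexI[where x = "S \<Oplus> T"])
         (auto simp: poly_eval_add[where I = I] poly_eval_const poly_eval_closed[where I = I] l_distr
           intro: indexed_pset.indexed_padd)
  next
    case (indexed_pmult A i)
    then obtain S where "S \<in> indexed_pset I (carrier R)"
      "\<forall>x. (\<forall>i\<in>I. x i \<in> carrier R) \<longrightarrow>
        poly_eval R S x = poly_eval R A x \<otimes> poly_eval R (indexed_const k) x" by blast
    then show ?case using indexed_pmult \<open>k \<in> carrier R\<close>
      by (intro bexI[where x = "S \<Otimes> i"])
         (auto simp: poly_eval_mult_var[where I = I] poly_eval_const
           poly_eval_closed[where I = I] m_ac intro: indexed_pset.indexed_pmult)
  qed
next
  case (indexed_padd A B)
  then obtain S T where "S \<in> indexed_pset I (carrier R)" "T \<in> indexed_pset I (carrier R)"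
    "\<forall>x. (\<forall>i\<in>I. x i \<in> carrier R) \<longrightarrow> poly_eval R S x = poly_eval R P x \<otimes> poly_eval R A x"
    "\<forall>x. (\<forall>i\<in>I. x i \<in> carrier R) \<longrightarrow> poly_eval R T x = poly_eval R P x \<otimes> poly_eval R B x" by blast
  then show ?case using indexed_padd P
    by (intro bexI[where x = "S \<Oplus> T"])
       (auto simp: poly_eval_add[where I = I] poly_eval_closed[where I = I] r_distr
         intro: indexed_pset.indexed_padd)
next
  case (indexed_pmult A i)
  then obtain S where "S \<in> indexed_pset I (carrier R)"
    "\<forall>x. (\<forall>i\<in>I. x i \<in> carrier R) \<longrightarrow> poly_eval R S x = poly_eval R P x \<otimes> poly_eval R A x" by blast
  then show ?case using indexed_pmult P
    by (intro bexI[where x = "S \<Otimes> i"])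
       (auto simp: poly_eval_mult_var[where I = I] poly_eval_closed[where I = I] m_assoc
         intro: indexed_pset.indexed_pmult)
qed

end


section \<open>Matrices and the Zariski topology\<close>

text \<open>The algebra of \<open>n \<times> n\<close> matrices over \<open>R\<close>. The matrix operations of the session
  \<open>Jordan_Normal_Form\<close> are tied to type classes; here the coefficients are a ring given by a
  record, so only the matrix type itself is used.\<close>

definition mat_alg :: "('a, 'b) ring_scheme \<Rightarrow> nat \<Rightarrow> ('a, 'a mat) module" where
  "mat_alg R n =
    \<lparr>carrier = {A \<in> carrier_mat n n. \<forall>i<n. \<forall>j<n. A $$ (i, j) \<in> carrier R},
     monoid.mult = (\<lambda>A B. mat n n (\<lambda>(i, j). \<Oplus>\<^bsub>R\<^esub>l\<in>{..<n}. A $$ (i, l) \<otimes>\<^bsub>R\<^esub> B $$ (l, j))),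
     one = mat n n (\<lambda>(i, j). if i = j then \<one>\<^bsub>R\<^esub> else \<zero>\<^bsub>R\<^esub>),
     zero = mat n n (\<lambda>_. \<zero>\<^bsub>R\<^esub>),
     add = (\<lambda>A B. mat n n (\<lambda>(i, j). A $$ (i, j) \<oplus>\<^bsub>R\<^esub> B $$ (i, j))),
     smult = (\<lambda>c A. mat n n (\<lambda>(i, j). c \<otimes>\<^bsub>R\<^esub> A $$ (i, j)))\<rparr>"

text \<open>The coordinate ring \<open>R[x\<^sub>i\<^sub>j]\<close> of the space of \<open>n \<times> n\<close> matrices.\<close>

definition mat_polys :: "('a, 'b) ring_scheme \<Rightarrow> nat \<Rightarrow> ((nat \<times> nat) multiset \<Rightarrow> 'a) set" where
  "mat_polys R n = ring.indexed_pset R ({..<n} \<times> {..<n}) (carrier R)"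

definition mat_eval :: "('a, 'b) ring_scheme \<Rightarrow> ((nat \<times> nat) multiset \<Rightarrow> 'a) \<Rightarrow> 'a mat \<Rightarrow> 'a" where
  "mat_eval R P A = poly_eval R P (\<lambda>ij. A $$ ij)"

definition zero_set ::
  "('a, 'b) ring_scheme \<Rightarrow> nat \<Rightarrow> ((nat \<times> nat) multiset \<Rightarrow> 'a) set \<Rightarrow> 'a mat set" where
  "zero_set R n S = {A \<in> carrier (mat_alg R n). \<forall>P\<in>S. mat_eval R P A = \<zero>\<^bsub>R\<^esub>}"

definition zariski :: "('a, 'b) ring_scheme \<Rightarrow> nat \<Rightarrow> 'a mat topology" where
  "zariski R n = topology (\<lambda>U. \<exists>S \<subseteq> mat_polys R n. U = carrier (mat_alg R n) - zero_set R n S)"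

context domain
begin

lemma istopology_zariski:
  "istopology (\<lambda>U. \<exists>S \<subseteq> mat_polys R n. U = carrier (mat_alg R n) - zero_set R n S)"
  (is "istopology ?op")
  unfolding istopology_def
proof (intro conjI allI impI)
  fix U V assume "?op U" "?op V"
  then obtain S T where S: "S \<subseteq> mat_polys R n" "U = carrier (mat_alg R n) - zero_set R n S"
    and T: "T \<subseteq> mat_polys R n" "V = carrier (mat_alg R n) - zero_set R n T" by blast
  let ?W = "{Q \<in> mat_polys R n. \<exists>A\<in>S. \<exists>B\<in>T. \<forall>x\<in>carrier (mat_alg R n).
              mat_eval R Q x = mat_eval R A x \<otimes> mat_eval R B x}"
  have coord: "x $$ ij \<in> carrier R"
    if "x \<in> carrier (mat_alg R n)" "ij \<in> {..<n} \<times> {..<n}" for x ij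
    using that by (auto simp: mat_alg_def)
  have ev: "mat_eval R P x \<in> carrier R"
    if "P \<in> mat_polys R n" "x \<in> carrier (mat_alg R n)" for P x
    unfolding mat_eval_def
    using that(1) coord[OF that(2)] unfolding mat_polys_def by (rule poly_eval_closed)
  have "x \<in> zero_set R n S \<union> zero_set R n T \<longleftrightarrow> x \<in> zero_set R n ?W"
    if x: "x \<in> carrier (mat_alg R n)" for x
  proof
    assume "x \<in> zero_set R n S \<union> zero_set R n T"
    then show "x \<in> zero_set R n ?W"
      unfolding zero_set_def using x ev S(1) T(1) by (auto simp: subset_iff)
  next
    assume W: "x \<in> zero_set R n ?W"
    show "x \<in> zero_set R n S \<union> zero_set R n T"
    proof (rule ccontr)
      assume "\<not> ?thesis"
      then obtain A B where A: "A \<in> S" "mat_eval R A x \<noteq> \<zero>" and B: "B \<in> T" "mat_eval R B x \<noteq> \<zero>"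
        using x unfolding zero_set_def by blast
      obtain Q where Q: "Q \<in> mat_polys R n" "\<forall>y. (\<forall>i\<in>{..<n} \<times> {..<n}. y i \<in> carrier R) \<longrightarrow>
          poly_eval R Q y = poly_eval R A y \<otimes> poly_eval R B y"
        using ex_poly_mult A(1) B(1) S(1) T(1) unfolding mat_polys_def by (meson subsetD)
      then have "Q \<in> ?W"
        using A B coord unfolding mat_eval_def by blast
      with W have "mat_eval R Q x = \<zero>" unfolding zero_set_def by blast
      moreover have "mat_eval R Q x = mat_eval R A x \<otimes> mat_eval R B x"
        using Q(2) coord[OF x] unfolding mat_eval_def by blast
      ultimately show False
        using A B ev x S(1) T(1) integral by (metis subsetD)
    qed
  qed
  then have "U \<inter> V = carrier (mat_alg R n) - zero_set R n ?W"
    unfolding S T by blast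
  then show "?op (U \<inter> V)" by (intro exI[of _ ?W]) auto
next
  fix \<K> assume "\<forall>U\<in>\<K>. ?op U"
  then obtain f where f: "\<And>U. U \<in> \<K> \<Longrightarrow> f U \<subseteq> mat_polys R n"
      "\<And>U. U \<in> \<K> \<Longrightarrow> U = carrier (mat_alg R n) - zero_set R n (f U)" by metis
  have "\<Union>\<K> = carrier (mat_alg R n) - zero_set R n (\<Union>U\<in>\<K>. f U)"
  proof (intro equalityI subsetI)
    fix x assume "x \<in> \<Union>\<K>"
    then obtain U where U: "U \<in> \<K>" "x \<in> U" by blast
    then have "x \<in> carrier (mat_alg R n) - zero_set R n (f U)" using f(2) by blast
    then show "x \<in> carrier (mat_alg R n) - zero_set R n (\<Union>U\<in>\<K>. f U)"
      using U by (auto simp: zero_set_def)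
  next
    fix x assume "x \<in> carrier (mat_alg R n) - zero_set R n (\<Union>U\<in>\<K>. f U)"
    then obtain U where U: "U \<in> \<K>" "x \<in> carrier (mat_alg R n) - zero_set R n (f U)"
      by (auto simp: zero_set_def)
    then show "x \<in> \<Union>\<K>" using f(2) by blast
  qed
  then show "?op (\<Union>\<K>)" using f(1) by (intro exI[of _ "\<Union>U\<in>\<K>. f U"]) auto
qed

lemma openin_zariski:
  "openin (zariski R n) U \<longleftrightarrow>
    (\<exists>S \<subseteq> mat_polys R n. U = carrier (mat_alg R n) - zero_set R n S)"
  unfolding zariski_def by (simp add: istopology_zariski)

lemma topspace_zariski: "topspace (zariski R n) = carrier (mat_alg R n)"
proof -
  have "indexed_const \<one> \<in> mat_polys R n"
    unfolding mat_polys_def by (intro indexed_pset.indexed_const) simp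
  moreover have "zero_set R n {indexed_const \<one>} = {}"
    by (auto simp: zero_set_def mat_eval_def poly_eval_const)
  ultimately have "openin (zariski R n) (carrier (mat_alg R n))"
    unfolding openin_zariski by (intro exI[of _ "{indexed_const \<one>}"]) auto
  moreover have "U \<subseteq> carrier (mat_alg R n)" if "openin (zariski R n) U" for U
    using that by (auto simp: openin_zariski)
  ultimately show ?thesis
    unfolding topspace_def by blast
qed

lemma closedin_zariski:
  "closedin (zariski R n) Z \<longleftrightarrow> (\<exists>S \<subseteq> mat_polys R n. Z = zero_set R n S)"
proof -
  have "zero_set R n S \<subseteq> carrier (mat_alg R n)" for S by (auto simp: zero_set_def)
  then show ?thesis
    unfolding closedin_def topspace_zariski openin_zariski by blast
qed

end


section \<open>Linear algebraic groups\<close>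

definition GL :: "('a, 'b) ring_scheme \<Rightarrow> nat \<Rightarrow> 'a mat monoid" where
  "GL R n = units_of (mat_alg R n)"

abbreviation subgroup_of_GL :: "('a, 'b) ring_scheme \<Rightarrow> nat \<Rightarrow> 'a mat set \<Rightarrow> 'a mat monoid" where
  "subgroup_of_GL R n G \<equiv> (GL R n)\<lparr>carrier := G\<rparr>"

definition closed_subgroup ::
  "('a, 'b) ring_scheme \<Rightarrow> nat \<Rightarrow> 'a mat set \<Rightarrow> 'a mat set \<Rightarrow> bool" where
  "closed_subgroup R n H G \<longleftrightarrow>
    subgroup H (subgroup_of_GL R n G) \<and> closedin (subtopology (zariski R n) G) H"

definition linear_algebraic_group :: "('a, 'b) ring_scheme \<Rightarrow> nat \<Rightarrow> 'a mat set \<Rightarrow> bool" where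
  "linear_algebraic_group R n G \<longleftrightarrow> closed_subgroup R n G (carrier (GL R n))"

definition unipotent :: "('a, 'b) ring_scheme \<Rightarrow> nat \<Rightarrow> 'a mat \<Rightarrow> bool" where
  "unipotent R n u \<longleftrightarrow>
    (\<exists>k::nat. (u \<ominus>\<^bsub>mat_alg R n\<^esub> \<one>\<^bsub>mat_alg R n\<^esub>) [^]\<^bsub>mat_alg R n\<^esub> k = \<zero>\<^bsub>mat_alg R n\<^esub>)"

text \<open>The unipotent radical is the largest closed connected normal unipotent subgroup. For a
  linear algebraic group over an algebraically closed field it always exists, since the product
  of two such subgroups is again one.\<close>

definition unipotent_radical :: "('a, 'b) ring_scheme \<Rightarrow> nat \<Rightarrow> 'a mat set \<Rightarrow> 'a mat set" where
  "unipotent_radical R n G =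
    (GREATEST U. closed_subgroup R n U G \<and> U \<lhd> subgroup_of_GL R n G \<and>
       connectedin (zariski R n) U \<and> (\<forall>u\<in>U. unipotent R n u))"

definition reductive :: "('a, 'b) ring_scheme \<Rightarrow> nat \<Rightarrow> 'a mat set \<Rightarrow> bool" where
  "reductive R n G \<longleftrightarrow> unipotent_radical R n G = {\<one>\<^bsub>GL R n\<^esub>}"


section \<open>Lie algebras and reductive pairs\<close>

text \<open>The tangent space at the identity: the matrices killed by the differentials at \<open>1\<close> of all
  polynomials vanishing on \<open>G\<close>. Since \<open>GL\<^sub>n\<close> is open in the space of matrices, it makes no
  difference that the inverse of the determinant is not among the coordinate functions.\<close>

definition lie_algebra :: "('a, 'b) ring_scheme \<Rightarrow> nat \<Rightarrow> 'a mat set \<Rightarrow> 'a mat set" where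
  "lie_algebra R n G =
    {A \<in> carrier (mat_alg R n). \<forall>P \<in> mat_polys R n. (\<forall>g\<in>G. mat_eval R P g = \<zero>\<^bsub>R\<^esub>) \<longrightarrow>
       (\<Oplus>\<^bsub>R\<^esub>ij\<in>{..<n} \<times> {..<n}.
          mat_eval R (poly_deriv R ij P) \<one>\<^bsub>mat_alg R n\<^esub> \<otimes>\<^bsub>R\<^esub> A $$ ij) = \<zero>\<^bsub>R\<^esub>}"

definition Ad :: "('a, 'b) ring_scheme \<Rightarrow> nat \<Rightarrow> 'a mat \<Rightarrow> 'a mat \<Rightarrow> 'a mat" where
  "Ad R n g A = g \<otimes>\<^bsub>mat_alg R n\<^esub> A \<otimes>\<^bsub>mat_alg R n\<^esub> inv\<^bsub>mat_alg R n\<^esub> g"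

definition Ad_submodule :: "('a, 'b) ring_scheme \<Rightarrow> nat \<Rightarrow> 'a mat set \<Rightarrow> 'a mat set \<Rightarrow> bool" where
  "Ad_submodule R n M W \<longleftrightarrow>
    submodule W R (mat_alg R n) \<and> (\<forall>m\<in>M. \<forall>A\<in>W. Ad R n m A \<in> W)"

definition reductive_pair ::
  "('a, 'b) ring_scheme \<Rightarrow> nat \<Rightarrow> 'a mat set \<Rightarrow> 'a mat set \<Rightarrow> bool" where
  "reductive_pair R n G M \<longleftrightarrow>
    Ad_submodule R n M (lie_algebra R n M) \<and>
    (\<exists>W. Ad_submodule R n M W \<and>
      lie_algebra R n M <+>\<^bsub>mat_alg R n\<^esub> W = lie_algebra R n G \<and>
      lie_algebra R n M \<inter> W = {\<zero>\<^bsub>mat_alg R n\<^esub>})"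


section \<open>Conjugacy classes of pairs\<close>

definition simult_conj ::
  "('a, 'b) ring_scheme \<Rightarrow> nat \<Rightarrow> 'a mat \<Rightarrow> 'a mat \<times> 'a mat \<Rightarrow> 'a mat \<times> 'a mat" where
  "simult_conj R n g = (\<lambda>(x, y).
    (g \<otimes>\<^bsub>GL R n\<^esub> x \<otimes>\<^bsub>GL R n\<^esub> inv\<^bsub>GL R n\<^esub> g, g \<otimes>\<^bsub>GL R n\<^esub> y \<otimes>\<^bsub>GL R n\<^esub> inv\<^bsub>GL R n\<^esub> g))"

definition pair_orbit ::
  "('a, 'b) ring_scheme \<Rightarrow> nat \<Rightarrow> 'a mat set \<Rightarrow> 'a mat \<times> 'a mat \<Rightarrow> ('a mat \<times> 'a mat) set" where
  "pair_orbit R n G = orbit (subgroup_of_GL R n G) (simult_conj R n)"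

definition pair_classes ::
  "('a, 'b) ring_scheme \<Rightarrow> nat \<Rightarrow> 'a mat set \<Rightarrow> ('a mat \<times> 'a mat) set set" where
  "pair_classes R n M = orbits (subgroup_of_GL R n M) (M \<times> M) (simult_conj R n)"

end

theory Submission
  imports Defs "HOL-Algebra.Algebraic_Closure_Type" "HOL-Library.Z2" "Jordan_Normal_Form.Determinant"
begin

text \<open>
  In characteristic 2 take \<open>G = Sp\<^sub>6\<close> and \<open>M = Sp\<^sub>4 \<times> Sp\<^sub>2\<close>, the stabiliser of an orthogonal
  decomposition \<open>V = V\<^sub>4 \<oplus> V\<^sub>2\<close>; the matrices of \<open>Lie G\<close> exchanging \<open>V\<^sub>4\<close> and \<open>V\<^sub>2\<close> form an
  \<open>M\<close>-stable complement of \<open>Lie M\<close>. Let \<open>R = k[n]/(n\<^sup>2)\<close> and let \<open>m\<^sub>1, m\<^sub>2 \<in> SL\<^sub>2(R)\<close> generate the algebra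
  of \<open>2 \<times> 2\<close> matrices over \<open>R\<close>, acting on \<open>V = k\<^sup>2 \<otimes> (R \<oplus> R/n)\<close>. The invariant symplectic forms
  correspond to symmetric forms over \<open>R\<close>: on \<open>k\<^sup>2 \<otimes> R\<close> the forms \<open>b\<^sub>t\<close> belonging to the units
  \<open>1 + t n\<close> are pairwise inequivalent, because in characteristic 2 the squares in \<open>R\<close> lie in \<open>k\<close>.
  But \<open>b\<^sub>t \<oplus> 1\<close> and \<open>b\<^sub>0 \<oplus> 1\<close> on \<open>R \<oplus> R/n\<close> are equivalent for every \<open>t = s\<^sup>2\<close>, by replacing the generator
  of \<open>R\<close> with \<open>(1, s)\<close>. Hence one \<open>G\<close>-orbit meets \<open>M\<^sup>2\<close> in infinitely many \<open>M\<close>-classes.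
\<close>

section \<open>Copies of a field as ring records\<close>

text \<open>A symmetric R-bilinear form with values in R becomes a k-form by taking the coefficient
  of n and tensoring with the symplectic form of k^2; this is why \<open>\<sigma>\<close> pairs e
  (x) 1 with f (x) n. On R/n the R-valued form lands in n k. Hence (1, s) has norm 1 + s^2 n, and (s
  n, 1) is orthogonal to it because s n + s n = 0. Away from characteristic 2 the unit 1 + t n is
  the square of 1 + (t/2) n, and all the forms b_t are equivalent. The entry 1 + n of the second
  generator puts n itself into the algebra generated by the pair; with entry 1 that algebra would be
  M_2(k) only, and too many matrices would commute with the pair. All computation takes place over a
  field that is a type, where the usual matrix calculus applies. The statement speaks of a ring
  record on \<open>nat set\<close>, so every notion is carried over along an injection
  \<open>\<phi>\<close>.\<close>

locale field_copy =
  fixes \<phi> :: "'a::field \<Rightarrow> 'b"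
  assumes inj: "inj \<phi>"
begin

abbreviation K where "K \<equiv> image_ring \<phi> (ring_of_type_algebra :: 'a ring)"

lemmas K_defs = image_ring_def image_group_def ring_of_type_algebra_def

lemma carrier_K: "carrier K = range \<phi>"
  by (simp add: K_defs monoid.defs)

lemma in_carrier [simp]: "\<phi> x \<in> carrier K"
  by (simp add: carrier_K)

lemma mult_K [simp]: "\<phi> x \<otimes>\<^bsub>K\<^esub> \<phi> y = \<phi> (x * y)"
  by (simp add: K_defs monoid.defs inj)

lemma add_K [simp]: "\<phi> x \<oplus>\<^bsub>K\<^esub> \<phi> y = \<phi> (x + y)"
  by (simp add: K_defs monoid.defs inj)

lemma one_K: "\<one>\<^bsub>K\<^esub> = \<phi> 1"
  by (simp add: K_defs monoid.defs)

lemma zero_K: "\<zero>\<^bsub>K\<^esub> = \<phi> 0"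
  by (simp add: K_defs monoid.defs)

lemma eq_K [simp]: "\<phi> x = \<phi> y \<longleftrightarrow> x = y"
  using inj by (simp add: inj_eq)

sublocale K: field K
  by (rule field.inj_imp_image_ring_is_field[OF field_from_type_algebra])
    (simp add: ring_of_type_algebra_def inj)

lemma finsum_K: "finsum K (\<lambda>i. \<phi> (f i)) A = \<phi> (sum f A)"
proof (induction A rule: infinite_finite_induct)
  case (infinite A)
  then show ?case by (simp add: K.add.finprod_infinite zero_K)
next
  case empty
  show ?case by (simp add: zero_K)
next
  case (insert i A)
  then show ?case by simp
qed

lemma finsum_K': "(\<And>i. i \<in> A \<Longrightarrow> g i = \<phi> (f i)) \<Longrightarrow> finsum K g A = \<phi> (sum f A)"
  by (subst finsum_K[symmetric]) (rule K.finsum_cong', auto)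

end

section \<open>The copied field: algebraic closedness and an embedding into
  \<open>nat set\<close>\<close>

lemma algebraically_closed_copy_ring:
  fixes \<phi> :: "'a::alg_closed_field \<Rightarrow> 'b"
  assumes "inj \<phi>"
  shows "algebraically_closed (image_ring \<phi> (ring_of_type_algebra :: 'a ring))"
proof -
  interpret field_copy \<phi> by unfold_locales (rule assms)
  show ?thesis
  proof (rule K.algebraically_closedI)
    fix p assume p: "p \<in> carrier (poly_ring K)" "1 < Polynomials.degree p"
    then have "set p \<subseteq> range \<phi>"
      by (auto simp: univ_poly_carrier[symmetric] polynomial_def carrier_K)
    then obtain cs where cs: "p = map \<phi> cs"
      by (metis ex_map_conv subsetD rangeE)
    \<comment> \<open>The lists read by \<open>K.eval\<close> start with the leading coefficient,
      those read by \<open>Poly\<close> with the constant one; hence \<open>rev\<close>.\<close>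
    have ev: "K.eval (map \<phi> ds) (\<phi> x) = \<phi> (poly (Poly (rev ds)) x)" for ds x
    proof (induction ds)
      case (Cons d ds)
      have pow: "\<phi> x [^]\<^bsub>K\<^esub> (n::nat) = \<phi> (x ^ n)" for n
        by (induction n) (simp_all add: one_K mult.commute)
      from Cons show ?case
        by (simp add: Poly_append poly_monom pow add.commute mult.commute)
    qed (simp add: zero_K)
    have "p \<noteq> []" "hd p \<noteq> \<zero>\<^bsub>K\<^esub>"
      using p by (auto simp: univ_poly_carrier[symmetric] polynomial_def)
    then have hd: "hd cs \<noteq> 0" "cs \<noteq> []"
      by (auto simp: cs zero_K hd_map)
    have "last (rev cs) \<noteq> 0"
      using hd by (simp add: last_rev)
    then have "coeffs (Poly (rev cs)) = rev cs"
      by (metis coeffs_Poly no_trailing_unfold strip_while_idem_iff)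
    then have "Polynomial.degree (Poly (rev cs)) = length cs - 1"
      by (simp add: degree_eq_length_coeffs)
    then have "Polynomial.degree (Poly (rev cs)) > 0"
      using p by (simp add: cs)
    then obtain x where "poly (Poly (rev cs)) x = 0"
      using alg_closed_imp_poly_has_root by blast
    then show "\<exists>x\<in>carrier K. K.eval p x = \<zero>\<^bsub>K\<^esub>"
      by (intro bexI[of _ "\<phi> x"]) (auto simp: cs ev zero_K)
  qed
qed

text \<open>An element of the closure is represented by a function from monomials to F_2, so the set
  of monomials with value 1 determines it. There are countably many monomials, which are coded as
  numbers by \<open>h\<close>.\<close>

lemma inj_alg_closure_bit: "\<exists>\<phi> :: bit alg_closure \<Rightarrow> nat set. inj \<phi>"
proof -
  have "\<exists>h :: (bit list \<times> nat) multiset \<Rightarrow> nat. inj h"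
  proof -
    have "inj (\<lambda>b::bit. b = 1)"
      by (rule injI) (metis bit_not_one_iff)
    \<comment> \<open>A multiset is coded by a list of its elements, with \<open>bit\<close>
      replaced by \<open>bool\<close>.\<close>
    then have "inj (to_nat \<circ> (map (map_prod (map (\<lambda>b::bit. b = 1)) (id :: nat \<Rightarrow> nat)) \<circ> inv_into UNIV mset))"
      by (intro inj_compose inj_to_nat list.inj_map prod.inj_map inj_on_id surj_imp_inj_inv)
        (simp_all add: surj_mset)
    then show ?thesis by blast
  qed
  then obtain h :: "(bit list \<times> nat) multiset \<Rightarrow> nat" where h: "inj h" by blast
  have "inj (\<lambda>x. h ` {m. Rep_alg_closure x m = 1})"
  proof (rule injI)
    fix x y assume "h ` {m. Rep_alg_closure x m = 1} = h ` {m. Rep_alg_closure y m = 1}"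
    then have "{m. Rep_alg_closure x m = 1} = {m. Rep_alg_closure y m = 1}"
      by (simp add: inj_image_eq_iff[OF h])
    then have "Rep_alg_closure x m = Rep_alg_closure y m" for m
    proof -
      have "Rep_alg_closure x m = 1 \<longleftrightarrow> Rep_alg_closure y m = 1"
        using \<open>{m. Rep_alg_closure x m = 1} = {m. Rep_alg_closure y m = 1}\<close>
        by (simp only: set_eq_iff mem_Collect_eq)
      then show ?thesis
        by (cases "Rep_alg_closure x m"; cases "Rep_alg_closure y m") simp_all
    qed
    then show "x = y"
      by (simp add: Rep_alg_closure_inject[symmetric] fun_eq_iff)
  qed
  then show ?thesis by blast
qed

lemma two_alg_closure_bit: "(1::bit alg_closure) + 1 = 0"
proof -
  have "(1::bit alg_closure) + 1 = to_ac (1 + 1)"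
    by (simp only: to_ac_add to_ac_1)
  also have "(1 + 1 :: bit) = 0"
    by simp
  finally show ?thesis
    by simp
qed

section \<open>Directional derivatives of polynomials\<close>

lemma (in domain) poly_deriv_const: "poly_deriv R i (indexed_const c) = indexed_const \<zero>"
  by (rule ext) (simp add: poly_deriv_def indexed_const_def)

lemma (in domain) poly_deriv_padd:
  assumes "P \<in> indexed_pset I (carrier R)" "Q \<in> indexed_pset I (carrier R)"
  shows "poly_deriv R i (P \<Oplus> Q) = poly_deriv R i P \<Oplus> poly_deriv R i Q"
  using indexed_pset_support[OF assms(1)] indexed_pset_support[OF assms(2)]
  by (intro ext) (simp add: poly_deriv_def indexed_padd_def add.nat_pow_distrib del: add.nat_pow_Suc)

text \<open>The product rule for a variable. For i = j the coefficient of m on the left is taken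
  \<open>count m i + 1\<close> times: \<open>count m i\<close> times from the first summand, once
  from the second.\<close>

lemma (in domain) poly_deriv_pmult:
  assumes "P \<in> indexed_pset I (carrier R)"
  shows "poly_deriv R i (P \<Otimes> j) =
    poly_deriv R i P \<Otimes> j \<Oplus> (if i = j then P else indexed_const \<zero>)"
proof
  fix m
  have c: "P m \<in> carrier R" for m using indexed_pset_support[OF assms] by blast
  show "poly_deriv R i (P \<Otimes> j) m =
    (poly_deriv R i P \<Otimes> j \<Oplus> (if i = j then P else indexed_const \<zero>)) m"
  proof (cases "i = j")
    case True
    show ?thesis
    proof (cases "j \<in># m")
      case mem: True
      then obtain m' where "m = add_mset j m'" by (metis mset_add)
      with True c show ?thesis
        by (simp add: poly_deriv_def indexed_pmult_def indexed_padd_def)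
    next
      case False
      then have "count m j = 0" by (simp add: count_eq_zero_iff)
      with False True c show ?thesis
        by (simp add: poly_deriv_def indexed_pmult_def indexed_padd_def)
    qed
  next
    case False
    show ?thesis
    proof (cases "j \<in># m")
      case mem: True
      then obtain m' where "m = add_mset j m'" by (metis mset_add)
      with False c show ?thesis
        by (simp add: poly_deriv_def indexed_pmult_def indexed_padd_def indexed_const_def
            add_mset_commute[of i j])
    next
      case mem: False
      with False c show ?thesis
        by (simp add: poly_deriv_def indexed_pmult_def indexed_padd_def indexed_const_def)
    qed
  qed
qed

lemma (in domain) poly_deriv_closed:
  assumes "P \<in> indexed_pset I (carrier R)"
  shows "poly_deriv R i P \<in> indexed_pset I (carrier R)"
  using assms
proof (induction rule: indexed_pset.induct)
  case (indexed_const c)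
  then show ?case by (auto simp: poly_deriv_const intro: indexed_pset.indexed_const)
next
  case (indexed_padd P Q)
  then show ?case by (auto simp: poly_deriv_padd intro: indexed_pset.indexed_padd)
next
  case (indexed_pmult P j)
  then show ?case
    by (auto simp: poly_deriv_pmult intro!: indexed_pset.indexed_padd indexed_pset.indexed_pmult
        indexed_pset.indexed_const)
qed

context field_copy
begin

text \<open>Lie algebras are defined by formal partial derivatives; restricting to the line x + a y
  turns a differential into the linear coefficient of a univariate polynomial. The induction works
  because multiplication by the variable j becomes multiplication by \<open>[:x j, y j:]\<close>,
  whose effect on the linear coefficient is the product rule.\<close>

lemma poly_on_line:
  assumes "P \<in> K.indexed_pset I (carrier K)"
    and I: "finite I" and z: "\<And>a i. i \<in> I \<Longrightarrow> z a i = \<phi> (x i + a * y i)"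
  shows "\<exists>p. (\<forall>a. poly_eval K P (z a) = \<phi> (poly p a)) \<and>
    (\<Oplus>\<^bsub>K\<^esub>i\<in>I. poly_eval K (poly_deriv K i P) (z 0) \<otimes>\<^bsub>K\<^esub> \<phi> (y i)) = \<phi> (Polynomial.coeff p 1)"
  using assms(1)
proof (induction rule: K.indexed_pset.induct)
  case (indexed_const c)
  then obtain d where d: "c = \<phi> d" by (auto simp: carrier_K)
  have "(\<Oplus>\<^bsub>K\<^esub>i\<in>I. poly_eval K (poly_deriv K i (K.indexed_const c)) (z 0) \<otimes>\<^bsub>K\<^esub> \<phi> (y i)) = \<phi> (\<Sum>i\<in>I. 0)"
    by (rule finsum_K') (simp add: K.poly_deriv_const K.poly_eval_const zero_K)
  with d show ?case
    by (intro exI[of _ "[:d:]"]) (simp add: K.poly_eval_const)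
next
  case (indexed_padd P Q)
  from indexed_padd.IH obtain p q where
    p: "\<And>a. poly_eval K P (z a) = \<phi> (poly p a)"
      "(\<Oplus>\<^bsub>K\<^esub>i\<in>I. poly_eval K (poly_deriv K i P) (z 0) \<otimes>\<^bsub>K\<^esub> \<phi> (y i)) = \<phi> (Polynomial.coeff p 1)" and
    q: "\<And>a. poly_eval K Q (z a) = \<phi> (poly q a)"
      "(\<Oplus>\<^bsub>K\<^esub>i\<in>I. poly_eval K (poly_deriv K i Q) (z 0) \<otimes>\<^bsub>K\<^esub> \<phi> (y i)) = \<phi> (Polynomial.coeff q 1)"
    by blast
  have zc: "z a i \<in> carrier K" if "i \<in> I" for a i using that by (simp add: z)
  have cl: "poly_eval K (poly_deriv K i P') (z 0) \<in> carrier K"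
    if "P' \<in> K.indexed_pset I (carrier K)" for i P'
    using K.poly_deriv_closed[OF that] zc by (rule K.poly_eval_closed)
  have "(\<Oplus>\<^bsub>K\<^esub>i\<in>I. poly_eval K (poly_deriv K i (K.indexed_padd P Q)) (z 0) \<otimes>\<^bsub>K\<^esub> \<phi> (y i)) =
    (\<Oplus>\<^bsub>K\<^esub>i\<in>I. poly_eval K (poly_deriv K i P) (z 0) \<otimes>\<^bsub>K\<^esub> \<phi> (y i) \<oplus>\<^bsub>K\<^esub>
       poly_eval K (poly_deriv K i Q) (z 0) \<otimes>\<^bsub>K\<^esub> \<phi> (y i))"
    using cl indexed_padd.hyps
    by (intro K.finsum_cong') (auto simp: K.poly_deriv_padd[OF indexed_padd.hyps]
        K.poly_eval_add[OF K.poly_deriv_closed K.poly_deriv_closed zc] K.l_distr)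
  also have "\<dots> = \<phi> (Polynomial.coeff p 1) \<oplus>\<^bsub>K\<^esub> \<phi> (Polynomial.coeff q 1)"
    using cl indexed_padd.hyps unfolding p(2)[symmetric] q(2)[symmetric]
    by (intro K.finsum_addf) auto
  finally show ?case
    using K.poly_eval_add[OF indexed_padd.hyps zc] p(1) q(1) by (intro exI[of _ "p + q"]) simp
next
  case (indexed_pmult P j)
  from indexed_pmult.IH obtain p where
    p: "\<And>a. poly_eval K P (z a) = \<phi> (poly p a)"
      "(\<Oplus>\<^bsub>K\<^esub>i\<in>I. poly_eval K (poly_deriv K i P) (z 0) \<otimes>\<^bsub>K\<^esub> \<phi> (y i)) = \<phi> (Polynomial.coeff p 1)"
    by blast
  note P = indexed_pmult.hyps(1)
  have zc: "z a i \<in> carrier K" if "i \<in> I" for a i using that by (simp add: z)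
  have cl: "poly_eval K (poly_deriv K i P) (z 0) \<in> carrier K" for i
    using K.poly_deriv_closed[OF P] zc by (rule K.poly_eval_closed)
  have clP: "(if i = j then P else K.indexed_const \<zero>\<^bsub>K\<^esub>) \<in> K.indexed_pset I (carrier K)" for i
    using P by (auto intro: K.indexed_pset.indexed_const)
  have ev: "poly_eval K (poly_deriv K i (K.indexed_pmult P j)) (z 0) =
    poly_eval K (poly_deriv K i P) (z 0) \<otimes>\<^bsub>K\<^esub> \<phi> (x j) \<oplus>\<^bsub>K\<^esub> \<phi> (if i = j then Polynomial.coeff p 0 else 0)" for i
    unfolding K.poly_deriv_pmult[OF P]
    using P indexed_pmult.hyps(2) cl
    by (subst K.poly_eval_add[OF _ clP zc])
      (auto simp: K.poly_eval_mult_var[OF K.poly_deriv_closed[OF P] indexed_pmult.hyps(2) zc] p(1) poly_0_coeff_0 zero_K[symmetric]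
        K.poly_eval_const z intro!: K.indexed_pset.indexed_pmult K.poly_deriv_closed)
  have "(\<Oplus>\<^bsub>K\<^esub>i\<in>I. poly_eval K (poly_deriv K i (K.indexed_pmult P j)) (z 0) \<otimes>\<^bsub>K\<^esub> \<phi> (y i)) =
    (\<Oplus>\<^bsub>K\<^esub>i\<in>I. (poly_eval K (poly_deriv K i P) (z 0) \<otimes>\<^bsub>K\<^esub> \<phi> (y i)) \<otimes>\<^bsub>K\<^esub> \<phi> (x j) \<oplus>\<^bsub>K\<^esub>
       \<phi> (if i = j then Polynomial.coeff p 0 * y i else 0))"
    using cl by (intro K.finsum_cong') (auto simp: ev K.l_distr K.m_assoc mult.commute)
  also have "\<dots> = \<phi> (Polynomial.coeff p 1) \<otimes>\<^bsub>K\<^esub> \<phi> (x j) \<oplus>\<^bsub>K\<^esub>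
      \<phi> (\<Sum>i\<in>I. if i = j then Polynomial.coeff p 0 * y i else 0)"
    using cl unfolding p(2)[symmetric] finsum_K[symmetric]
    by (subst K.finsum_addf) (auto simp: K.finsum_ldistr I)
  also have "(\<Sum>i\<in>I. if i = j then Polynomial.coeff p 0 * y i else 0) = Polynomial.coeff p 0 * y j"
    using I indexed_pmult.hyps(2) by simp
  finally show ?case
    using K.poly_eval_mult_var[OF P indexed_pmult.hyps(2) zc] p(1) indexed_pmult.hyps(2)
    by (intro exI[of _ "p * [:x j, y j:]"]) (simp add: z coeff_mult algebra_simps)
qed

end

section \<open>Matrix groups over the copied field\<close>

text \<open>Subgroups of GL_n over the field type, so that the group theory can be done before
  anything is copied.\<close>

definition matrix_group :: "nat \<Rightarrow> 'a::field mat set \<Rightarrow> bool" where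
  "matrix_group n S \<longleftrightarrow> S \<subseteq> carrier_mat n n \<and> 1\<^sub>m n \<in> S \<and> (\<forall>A\<in>S. \<forall>B\<in>S. A * B \<in> S) \<and>
    (\<forall>A\<in>S. \<exists>B\<in>S. A * B = 1\<^sub>m n \<and> B * A = 1\<^sub>m n)"

context field_copy
begin

abbreviation \<Phi> where "\<Phi> \<equiv> map_mat \<phi>"

lemma \<Phi>_eq [simp]: "\<Phi> A = \<Phi> B \<longleftrightarrow> A = B"
  by (auto simp: mat_eq_iff)

lemma carrier_mat_alg: "carrier (mat_alg K n) = \<Phi> ` carrier_mat n n"
proof (intro equalityI subsetI)
  fix A assume A: "A \<in> carrier (mat_alg K n)"
  then have "A = \<Phi> (map_mat (the_inv \<phi>) A)"
    by (intro eq_matI) (auto simp: mat_alg_def carrier_K f_the_inv_into_f[OF inj])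
  moreover have "map_mat (the_inv \<phi>) A \<in> carrier_mat n n"
    using A by (auto simp: mat_alg_def)
  ultimately show "A \<in> \<Phi> ` carrier_mat n n" by blast
qed (auto simp: mat_alg_def)

lemma \<Phi>_mult [simp]:
  assumes "A \<in> carrier_mat n n" "B \<in> carrier_mat n n"
  shows "\<Phi> A \<otimes>\<^bsub>mat_alg K n\<^esub> \<Phi> B = \<Phi> (A * B)"
proof (rule eq_matI)
  fix i j assume "i < dim_row (\<Phi> (A * B))" "j < dim_col (\<Phi> (A * B))"
  then have ij: "i < n" "j < n" using assms by auto
  have "(\<Oplus>\<^bsub>K\<^esub>l\<in>{..<n}. \<Phi> A $$ (i, l) \<otimes>\<^bsub>K\<^esub> \<Phi> B $$ (l, j)) = \<phi> (\<Sum>l<n. A $$ (i, l) * B $$ (l, j))"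
    using assms ij by (intro finsum_K') auto
  also have "(\<Sum>l<n. A $$ (i, l) * B $$ (l, j)) = (A * B) $$ (i, j)"
    using assms ij by (auto simp: scalar_prod_def atLeast0LessThan)
  finally show "(\<Phi> A \<otimes>\<^bsub>mat_alg K n\<^esub> \<Phi> B) $$ (i, j) = \<Phi> (A * B) $$ (i, j)"
    using assms ij by (simp add: mat_alg_def)
qed (use assms in \<open>auto simp: mat_alg_def\<close>)

lemma \<Phi>_add [simp]:
  assumes "A \<in> carrier_mat n n" "B \<in> carrier_mat n n"
  shows "\<Phi> A \<oplus>\<^bsub>mat_alg K n\<^esub> \<Phi> B = \<Phi> (A + B)"
  using assms by (intro eq_matI) (auto simp: mat_alg_def)

lemma \<Phi>_smult [simp]:
  assumes "A \<in> carrier_mat n n"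
  shows "\<phi> c \<odot>\<^bsub>mat_alg K n\<^esub> \<Phi> A = \<Phi> (c \<cdot>\<^sub>m A)"
  using assms by (intro eq_matI) (auto simp: mat_alg_def)

lemma one_mat_alg: "\<one>\<^bsub>mat_alg K n\<^esub> = \<Phi> (1\<^sub>m n)"
  by (intro eq_matI) (auto simp: mat_alg_def one_K zero_K)

lemma zero_mat_alg: "\<zero>\<^bsub>mat_alg K n\<^esub> = \<Phi> (0\<^sub>m n n)"
  by (intro eq_matI) (auto simp: mat_alg_def zero_K)

lemma ring_mat_alg: "ring (mat_alg K n)"
proof (rule ringI)
  show "abelian_group (mat_alg K n)"
  proof (rule abelian_groupI)
    fix x assume "x \<in> carrier (mat_alg K n)"
    then obtain A where "x = \<Phi> A" "A \<in> carrier_mat n n" by (auto simp: carrier_mat_alg)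
    then show "\<exists>y\<in>carrier (mat_alg K n). y \<oplus>\<^bsub>mat_alg K n\<^esub> x = \<zero>\<^bsub>mat_alg K n\<^esub>"
      by (intro bexI[of _ "\<Phi> (- A)"]) (auto simp: carrier_mat_alg zero_mat_alg uminus_l_inv_mat)
  qed (auto simp: carrier_mat_alg zero_mat_alg assoc_add_mat[where nr = n and nc = n]
      comm_add_mat[where nr = n and nc = n])
  show "Group.monoid (mat_alg K n)"
    by (rule monoidI) (auto simp: carrier_mat_alg one_mat_alg)
qed (auto simp: carrier_mat_alg add_mult_distrib_mat[where nr = n and n = n and nc = n]
    mult_add_distrib_mat[where nr = n and n = n and nc = n])

sublocale M: ring "mat_alg K n" for n
  by (rule ring_mat_alg)

lemma \<Phi>_closed [simp]: "A \<in> carrier_mat n n \<Longrightarrow> \<Phi> A \<in> carrier (mat_alg K n)"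
  by (simp add: carrier_mat_alg)

lemma \<Phi>_minus [simp]:
  assumes "A \<in> carrier_mat n n" "B \<in> carrier_mat n n"
  shows "\<Phi> A \<ominus>\<^bsub>mat_alg K n\<^esub> \<Phi> B = \<Phi> (A - B)"
proof -
  have "\<ominus>\<^bsub>mat_alg K n\<^esub> \<Phi> B = \<Phi> (- B)"
    using assms by (intro M.minus_equality) (auto simp: zero_mat_alg uminus_l_inv_mat)
  then show ?thesis
    using assms by (simp add: a_minus_def minus_add_uminus_mat[where nr = n and nc = n])
qed

lemma \<Phi>_pow [simp]:
  assumes "A \<in> carrier_mat n n"
  shows "\<Phi> A [^]\<^bsub>mat_alg K n\<^esub> (m::nat) = \<Phi> (A ^\<^sub>m m)"
  using assms by (induction m) (auto simp: one_mat_alg)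

lemma unipotent_\<Phi>:
  assumes "A \<in> carrier_mat n n"
  shows "unipotent K n (\<Phi> A) \<longleftrightarrow> (\<exists>m. (A - 1\<^sub>m n) ^\<^sub>m m = 0\<^sub>m n n)"
  using assms
  by (simp add: unipotent_def one_mat_alg zero_mat_alg \<Phi>_pow[OF minus_carrier_mat[OF one_carrier_mat]])

lemma \<Phi>_inv:
  assumes "A \<in> carrier_mat n n" "B \<in> carrier_mat n n" "A * B = 1\<^sub>m n" "B * A = 1\<^sub>m n"
  shows "\<Phi> A \<in> Units (mat_alg K n)" "inv\<^bsub>mat_alg K n\<^esub> \<Phi> A = \<Phi> B"
    "inv\<^bsub>GL K n\<^esub> \<Phi> A = \<Phi> B"
proof -
  show u: "\<Phi> A \<in> Units (mat_alg K n)"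
    using assms by (auto simp: Units_def one_mat_alg intro!: bexI[of _ "\<Phi> B"])
  show "inv\<^bsub>mat_alg K n\<^esub> \<Phi> A = \<Phi> B"
    using assms by (intro M.inv_unique'[symmetric]) (auto simp: one_mat_alg)
  with u show "inv\<^bsub>GL K n\<^esub> \<Phi> A = \<Phi> B"
    by (simp add: GL_def M.units_of_inv)
qed

lemma group_GL: "group (GL K n)"
  unfolding GL_def by (rule M.units_group)

lemma GL_simps:
  "carrier (GL K n) = Units (mat_alg K n)" "\<one>\<^bsub>GL K n\<^esub> = \<Phi> (1\<^sub>m n)"
  "x \<otimes>\<^bsub>GL K n\<^esub> y = x \<otimes>\<^bsub>mat_alg K n\<^esub> y"
  by (simp_all add: GL_def units_of_def one_mat_alg)

lemma subgroup_\<Phi>_GL: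
  assumes "matrix_group n S"
  shows "subgroup (\<Phi> ` S) (GL K n)"
proof
  note S = assms[unfolded matrix_group_def]
  show "\<Phi> ` S \<subseteq> carrier (GL K n)"
  proof
    fix x assume "x \<in> \<Phi> ` S"
    then obtain A B where "x = \<Phi> A" "A \<in> S" "B \<in> S" "A * B = 1\<^sub>m n" "B * A = 1\<^sub>m n"
      using S by blast
    then show "x \<in> carrier (GL K n)"
      using S \<Phi>_inv(1)[of A n B] by (auto simp: GL_simps)
  qed
  show "x \<otimes>\<^bsub>GL K n\<^esub> y \<in> \<Phi> ` S" if xy: "x \<in> \<Phi> ` S" "y \<in> \<Phi> ` S" for x y
  proof -
    obtain A B where "x = \<Phi> A" "A \<in> S" "y = \<Phi> B" "B \<in> S" using xy by blast
    moreover from this have "\<Phi> A \<otimes>\<^bsub>mat_alg K n\<^esub> \<Phi> B = \<Phi> (A * B)"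
      using S by (intro \<Phi>_mult) auto
    ultimately show ?thesis using S by (auto simp: GL_simps)
  qed
  show "\<one>\<^bsub>GL K n\<^esub> \<in> \<Phi> ` S"
    using S by (simp add: GL_simps)
  show "inv\<^bsub>GL K n\<^esub> x \<in> \<Phi> ` S" if x: "x \<in> \<Phi> ` S" for x
  proof -
    obtain A B where AB: "x = \<Phi> A" "A \<in> S" "B \<in> S" "A * B = 1\<^sub>m n" "B * A = 1\<^sub>m n"
      using S x by blast
    then have "inv\<^bsub>GL K n\<^esub> \<Phi> A = \<Phi> B"
      using S by (intro \<Phi>_inv) auto
    with AB show ?thesis by simp
  qed
qed

lemma subgroup_\<Phi>:
  assumes "matrix_group n S" "matrix_group n T" "S \<subseteq> T"
  shows "subgroup (\<Phi> ` S) (subgroup_of_GL K n (\<Phi> ` T))"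
  using assms by (intro group.subgroup_incl[OF group_GL] subgroup_\<Phi>_GL) auto

text \<open>Polynomial functions instead of polynomials: equations can be written with matrix
  entries and ordinary sums and products, and the closure rules below supply the coefficient
  functions.\<close>

definition polyfun :: "nat \<Rightarrow> ('a mat \<Rightarrow> 'a) \<Rightarrow> bool" where
  "polyfun n f \<longleftrightarrow> (\<exists>P\<in>mat_polys K n. \<forall>A\<in>carrier_mat n n. mat_eval K P (\<Phi> A) = \<phi> (f A))"

lemma polyfun_const: "polyfun n (\<lambda>_. c)"
  unfolding polyfun_def mat_polys_def mat_eval_def
  by (intro bexI[of _ "K.indexed_const (\<phi> c)"]) (auto simp: K.poly_eval_const intro: K.indexed_pset.indexed_const)

lemma \<Phi>_entry_closed: "A \<in> carrier_mat n n \<Longrightarrow> ij \<in> {..<n} \<times> {..<n} \<Longrightarrow> \<Phi> A $$ ij \<in> carrier K"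
  by auto

lemma polyfun_add:
  assumes "polyfun n f" "polyfun n g"
  shows "polyfun n (\<lambda>A. f A + g A)"
proof -
  obtain P Q where "P \<in> mat_polys K n" "\<And>A. A \<in> carrier_mat n n \<Longrightarrow> mat_eval K P (\<Phi> A) = \<phi> (f A)"
    "Q \<in> mat_polys K n" "\<And>A. A \<in> carrier_mat n n \<Longrightarrow> mat_eval K Q (\<Phi> A) = \<phi> (g A)"
    using assms unfolding polyfun_def by blast
  then show ?thesis
    unfolding polyfun_def mat_polys_def mat_eval_def
    by (intro bexI[of _ "K.indexed_padd P Q"])
      (auto simp: K.poly_eval_add[OF _ _ \<Phi>_entry_closed] intro: K.indexed_pset.indexed_padd)
qed

lemma polyfun_mult:
  assumes "polyfun n f" "polyfun n g"
  shows "polyfun n (\<lambda>A. f A * g A)"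
proof -
  obtain P Q where PQ: "P \<in> mat_polys K n" "\<And>A. A \<in> carrier_mat n n \<Longrightarrow> mat_eval K P (\<Phi> A) = \<phi> (f A)"
    "Q \<in> mat_polys K n" "\<And>A. A \<in> carrier_mat n n \<Longrightarrow> mat_eval K Q (\<Phi> A) = \<phi> (g A)"
    using assms unfolding polyfun_def by blast
  then obtain S where S: "S \<in> mat_polys K n" "\<And>x. (\<forall>i\<in>{..<n} \<times> {..<n}. x i \<in> carrier K) \<Longrightarrow>
      poly_eval K S x = poly_eval K P x \<otimes>\<^bsub>K\<^esub> poly_eval K Q x"
    unfolding mat_polys_def by (meson K.ex_poly_mult)
  have "mat_eval K S (\<Phi> A) = \<phi> (f A * g A)" if "A \<in> carrier_mat n n" for A
    using PQ(2,4)[OF that] S(2)[of "\<lambda>ij. \<Phi> A $$ ij"] \<Phi>_entry_closed[OF that]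
    unfolding mat_eval_def by simp
  with S(1) show ?thesis
    unfolding polyfun_def by blast
qed

lemma polyfun_sum: "(\<And>i. i \<in> I \<Longrightarrow> polyfun n (f i)) \<Longrightarrow> polyfun n (\<lambda>A. \<Sum>i\<in>I. f i A)"
  by (induction I rule: infinite_finite_induct) (auto intro: polyfun_const polyfun_add)

lemma polyfun_entry:
  assumes "i < n" "j < n"
  shows "polyfun n (\<lambda>A. A $$ (i, j))"
proof -
  have c: "K.indexed_const \<one>\<^bsub>K\<^esub> \<in> K.indexed_pset ({..<n} \<times> {..<n}) (carrier K)"
    by (intro K.indexed_pset.indexed_const) simp
  have "K.indexed_pmult (K.indexed_const \<one>\<^bsub>K\<^esub>) (i, j) \<in> mat_polys K n"
    unfolding mat_polys_def using c assms by (intro K.indexed_pset.indexed_pmult) auto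
  moreover have "mat_eval K (K.indexed_pmult (K.indexed_const \<one>\<^bsub>K\<^esub>) (i, j)) (\<Phi> A) = \<phi> (A $$ (i, j))"
    if "A \<in> carrier_mat n n" for A
    unfolding mat_eval_def using assms that
    by (subst K.poly_eval_mult_var[OF c _ \<Phi>_entry_closed[OF that]]) (auto simp: K.poly_eval_const)
  ultimately show ?thesis
    unfolding polyfun_def by blast
qed

lemma closedin_zariski_polyfuns:
  assumes "\<And>f. f \<in> F \<Longrightarrow> polyfun n f"
  shows "closedin (zariski K n) (\<Phi> ` {A \<in> carrier_mat n n. \<forall>f\<in>F. f A = 0})"
proof -
  \<comment> \<open>Taking every polynomial that represents some member of \<open>F\<close> avoids
    choosing representatives.\<close>
  let ?S = "{P \<in> mat_polys K n. \<exists>f\<in>F. \<forall>A\<in>carrier_mat n n. mat_eval K P (\<Phi> A) = \<phi> (f A)}"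
  have "\<Phi> ` {A \<in> carrier_mat n n. \<forall>f\<in>F. f A = 0} = zero_set K n ?S"
  proof (intro equalityI subsetI)
    fix x assume "x \<in> zero_set K n ?S"
    then obtain A where A: "x = \<Phi> A" "A \<in> carrier_mat n n" "\<And>P. P \<in> ?S \<Longrightarrow> mat_eval K P x = \<zero>\<^bsub>K\<^esub>"
      unfolding zero_set_def carrier_mat_alg by blast
    have "f A = 0" if f: "f \<in> F" for f
    proof -
      obtain P where P: "P \<in> mat_polys K n" "\<And>B. B \<in> carrier_mat n n \<Longrightarrow> mat_eval K P (\<Phi> B) = \<phi> (f B)"
        using assms[OF f] unfolding polyfun_def by blast
      have "P \<in> ?S"
        using P f by (intro CollectI conjI bexI[of _ f] ballI)
      then have "\<phi> (f A) = \<phi> 0"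
        using A P(2)[OF A(2)] by (simp add: zero_K)
      then show ?thesis by simp
    qed
    with A show "x \<in> \<Phi> ` {A \<in> carrier_mat n n. \<forall>f\<in>F. f A = 0}" by blast
  qed (auto simp: zero_set_def zero_K)
  moreover have "?S \<subseteq> mat_polys K n"
    by (rule Collect_restrict)
  ultimately show ?thesis
    unfolding K.closedin_zariski by (intro exI conjI)
qed

section \<open>Closed subgroups and a criterion for reductivity\<close>

lemma closed_subgroup_\<Phi>:
  assumes "matrix_group n S" "matrix_group n T" "S \<subseteq> T" "closedin (zariski K n) (\<Phi> ` S)"
  shows "closed_subgroup K n (\<Phi> ` S) (\<Phi> ` T)"
  unfolding closed_subgroup_def closedin_subtopology using assms subgroup_\<Phi>[OF assms(1-3)]
  by (auto intro!: exI[of _ "\<Phi> ` S"])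

lemma linear_algebraic_group_\<Phi>:
  assumes "matrix_group n S" "closedin (zariski K n) (\<Phi> ` S)"
  shows "linear_algebraic_group K n (\<Phi> ` S)"
proof -
  have "subgroup (\<Phi> ` S) (GL K n)" by (rule subgroup_\<Phi>_GL) fact
  then show ?thesis
    unfolding linear_algebraic_group_def closed_subgroup_def closedin_subtopology
    using assms subgroup.subset by (auto intro!: exI[of _ "\<Phi> ` S"])
qed

text \<open>Since the radical is a \<open>GREATEST\<close>, the trivial group has to be shown to
  qualify and to contain every competitor. The second part becomes a purely group-theoretic question
  about normal subgroups of unipotent matrices.\<close>

lemma reductive_\<Phi>:
  assumes S: "matrix_group n S"
    and trivial: "\<And>U. U \<subseteq> S \<Longrightarrow> matrix_group n U \<Longrightarrow>
      (\<And>A B u. A \<in> S \<Longrightarrow> B \<in> S \<Longrightarrow> A * B = 1\<^sub>m n \<Longrightarrow> B * A = 1\<^sub>m n \<Longrightarrow> u \<in> U \<Longrightarrow> A * u * B \<in> U) \<Longrightarrow>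
      (\<And>u. u \<in> U \<Longrightarrow> \<exists>m. (u - 1\<^sub>m n) ^\<^sub>m m = 0\<^sub>m n n) \<Longrightarrow> U \<subseteq> {1\<^sub>m n}"
  shows "reductive K n (\<Phi> ` S)"
  unfolding reductive_def unipotent_radical_def
proof (rule Greatest_equality, intro conjI ballI)
  note S' = S[unfolded matrix_group_def]
  have grp: "group (subgroup_of_GL K n (\<Phi> ` S))"
    by (rule subgroup.subgroup_is_group[OF subgroup_\<Phi>_GL[OF S] group_GL])
  have 1: "matrix_group n {1\<^sub>m n :: 'a mat}"
    by (auto simp: matrix_group_def)
  have one: "{\<one>\<^bsub>GL K n\<^esub>} = \<Phi> ` {1\<^sub>m n}" by (simp add: GL_simps)
  have eq: "{1\<^sub>m n} = {A \<in> carrier_mat n n. \<forall>f\<in>(\<lambda>(i, j) A. A $$ (i, j) + (if i = j then - 1 else 0)) ` ({..<n} \<times> {..<n}). f A = (0::'a)}"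
    by (auto simp: mat_eq_iff add_eq_0_iff2 split: if_splits)
  have "closedin (zariski K n) (\<Phi> ` {1\<^sub>m n})"
    unfolding eq by (rule closedin_zariski_polyfuns) (auto intro!: polyfun_add polyfun_entry polyfun_const)
  then show "closed_subgroup K n {\<one>\<^bsub>GL K n\<^esub>} (\<Phi> ` S)"
    unfolding one using S' by (intro closed_subgroup_\<Phi>[OF 1 S]) auto
  show "{\<one>\<^bsub>GL K n\<^esub>} \<lhd> subgroup_of_GL K n (\<Phi> ` S)"
    using group.one_is_normal[OF grp] by simp
  show "connectedin (zariski K n) {\<one>\<^bsub>GL K n\<^esub>}"
    by (simp add: connectedin_sing K.topspace_zariski GL_simps)
  show "unipotent K n u" if "u \<in> {\<one>\<^bsub>GL K n\<^esub>}" for u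
  proof -
    have "(1\<^sub>m n - 1\<^sub>m n :: 'a mat) ^\<^sub>m 1 = 0\<^sub>m n n"
      by (simp add: minus_r_inv_mat[of _ n n])
    then have "unipotent K n (\<Phi> (1\<^sub>m n))"
      unfolding unipotent_\<Phi>[OF one_carrier_mat] by (rule exI)
    with that show ?thesis by (simp add: GL_simps)
  qed
  fix Y assume Y: "closed_subgroup K n Y (\<Phi> ` S) \<and> Y \<lhd> subgroup_of_GL K n (\<Phi> ` S) \<and>
    connectedin (zariski K n) Y \<and> (\<forall>u\<in>Y. unipotent K n u)"
  define U where "U = {A \<in> S. \<Phi> A \<in> Y}"
  interpret Y: normal Y "subgroup_of_GL K n (\<Phi> ` S)" using Y by blast
  have YU: "Y = \<Phi> ` U" using Y.subset by (auto simp: U_def)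
  have inv: "inv\<^bsub>subgroup_of_GL K n (\<Phi> ` S)\<^esub> \<Phi> A = \<Phi> B"
    if "A \<in> S" "B \<in> S" "A * B = 1\<^sub>m n" "B * A = 1\<^sub>m n" for A B
    using that S' \<Phi>_inv(3)[of A n B] group.m_inv_consistent[OF group_GL subgroup_\<Phi>_GL[OF S], of "\<Phi> A"]
    by auto
  have mult: "\<Phi> A \<otimes>\<^bsub>GL K n\<^esub> \<Phi> B = \<Phi> (A * B)" if "A \<in> S" "B \<in> S" for A B
  proof -
    have "A \<in> carrier_mat n n" "B \<in> carrier_mat n n" using that S' by blast+
    then show ?thesis by (simp add: GL_simps)
  qed
  have "U \<subseteq> {1\<^sub>m n}"
  proof (rule trivial)
    show "matrix_group n U"
      unfolding matrix_group_def
    proof (intro conjI ballI)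
      have "\<Phi> (1\<^sub>m n) = \<one>\<^bsub>subgroup_of_GL K n (\<Phi> ` S)\<^esub>"
        by (simp add: GL_simps)
      then have "\<Phi> (1\<^sub>m n) \<in> Y"
        by (simp only: subgroup.one_closed[OF Y.subgroup_axioms])
      then show "1\<^sub>m n \<in> U"
        using S' by (simp add: U_def)
      show "A * B \<in> U" if "A \<in> U" "B \<in> U" for A B
        using that subgroup.m_closed[OF Y.subgroup_axioms, of "\<Phi> A" "\<Phi> B"] mult[of A B] S' by (auto simp: U_def)
      show "\<exists>B\<in>U. A * B = 1\<^sub>m n \<and> B * A = 1\<^sub>m n" if A: "A \<in> U" for A
      proof -
        obtain B where B: "B \<in> S" "A * B = 1\<^sub>m n" "B * A = 1\<^sub>m n"
          using A S' by (auto simp: U_def)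
        then have "\<Phi> B \<in> Y" using A inv[of A B] subgroup.m_inv_closed[OF Y.subgroup_axioms, of "\<Phi> A"] by (auto simp: U_def)
        with B show ?thesis by (auto simp: U_def)
      qed
    qed (use S' in \<open>auto simp: U_def\<close>)
    show "A * u * B \<in> U" if "A \<in> S" "B \<in> S" "A * B = 1\<^sub>m n" "B * A = 1\<^sub>m n" "u \<in> U" for A B u
    proof -
      have "\<Phi> A \<otimes>\<^bsub>subgroup_of_GL K n (\<Phi> ` S)\<^esub> \<Phi> u \<otimes>\<^bsub>subgroup_of_GL K n (\<Phi> ` S)\<^esub> \<Phi> B \<in> Y"
        using Y.inv_op_closed2[of "\<Phi> A" "\<Phi> u"] inv[of A B] that by (auto simp: U_def)
      moreover have "A * u \<in> S" "A * u * B \<in> S" using that S' by (auto simp: U_def)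
      ultimately show ?thesis
        using that by (simp add: mult U_def)
    qed
    show "\<exists>m. (u - 1\<^sub>m n) ^\<^sub>m m = 0\<^sub>m n n" if "u \<in> U" for u
      using that Y S' unipotent_\<Phi>[of u n] by (auto simp: U_def)
  qed (auto simp: U_def)
  then show "Y \<subseteq> {\<one>\<^bsub>GL K n\<^esub>}"
    by (auto simp: YU GL_simps)
qed

section \<open>Tangent vectors at the identity, tested along lines\<close>

lemma mat_poly_on_line:
  assumes "P \<in> mat_polys K n" and N: "N \<in> carrier_mat n n"
  shows "\<exists>p. (\<forall>a. mat_eval K P (\<Phi> (1\<^sub>m n + a \<cdot>\<^sub>m N)) = \<phi> (poly p a)) \<and>
    (\<Oplus>\<^bsub>K\<^esub>ij\<in>{..<n} \<times> {..<n}.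
      mat_eval K (poly_deriv K ij P) \<one>\<^bsub>mat_alg K n\<^esub> \<otimes>\<^bsub>K\<^esub> \<Phi> N $$ ij) = \<phi> (Polynomial.coeff p 1)"
proof -
  let ?I = "{..<n} \<times> {..<n}"
  have P: "P \<in> K.indexed_pset ?I (carrier K)" using assms(1) by (simp add: mat_polys_def)
  have 0: "1\<^sub>m n + 0 \<cdot>\<^sub>m N = 1\<^sub>m n" using N by (intro eq_matI) auto
  obtain p where p: "\<And>a. poly_eval K P (\<lambda>ij. \<Phi> (1\<^sub>m n + a \<cdot>\<^sub>m N) $$ ij) = \<phi> (poly p a)"
    "(\<Oplus>\<^bsub>K\<^esub>ij\<in>?I. poly_eval K (poly_deriv K ij P) (\<lambda>ij. \<Phi> (1\<^sub>m n + 0 \<cdot>\<^sub>m N) $$ ij) \<otimes>\<^bsub>K\<^esub> \<phi> (N $$ ij)) =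
      \<phi> (Polynomial.coeff p 1)"
    using poly_on_line[OF P, of "\<lambda>a ij. \<Phi> (1\<^sub>m n + a \<cdot>\<^sub>m N) $$ ij" "\<lambda>ij. 1\<^sub>m n $$ ij" "\<lambda>ij. N $$ ij"] N
    by auto
  have "poly_eval K (poly_deriv K ij P) (\<lambda>ij. \<Phi> (1\<^sub>m n) $$ ij) \<in> carrier K" for ij
    by (rule K.poly_eval_closed[OF K.poly_deriv_closed[OF P]]) auto
  then have "(\<Oplus>\<^bsub>K\<^esub>ij\<in>?I.
      mat_eval K (poly_deriv K ij P) \<one>\<^bsub>mat_alg K n\<^esub> \<otimes>\<^bsub>K\<^esub> \<Phi> N $$ ij) = \<phi> (Polynomial.coeff p 1)"
    unfolding p(2)[symmetric] 0 mat_eval_def one_mat_alg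
    using N by (intro K.finsum_cong') auto
  with p(1) show ?thesis unfolding mat_eval_def by blast
qed

text \<open>Writes the tangent condition as a linear form over the field type, from which closure
  under linear combinations follows.\<close>

lemma lie_algebra_linear:
  assumes "P \<in> mat_polys K n"
  shows "\<exists>d. \<forall>N\<in>carrier_mat n n.
    (\<Oplus>\<^bsub>K\<^esub>ij\<in>{..<n} \<times> {..<n}.
      mat_eval K (poly_deriv K ij P) \<one>\<^bsub>mat_alg K n\<^esub> \<otimes>\<^bsub>K\<^esub> \<Phi> N $$ ij) =
    \<phi> (\<Sum>ij\<in>{..<n} \<times> {..<n}. d ij * N $$ ij)"
proof -
  have "mat_eval K (poly_deriv K ij P) \<one>\<^bsub>mat_alg K n\<^esub> \<in> carrier K" for ij
    using assms unfolding mat_eval_def one_mat_alg mat_polys_def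
    by (intro K.poly_eval_closed[OF K.poly_deriv_closed]) auto
  then have "\<forall>ij. \<exists>c. mat_eval K (poly_deriv K ij P) \<one>\<^bsub>mat_alg K n\<^esub> = \<phi> c"
    by (auto simp: carrier_K)
  then obtain d where d: "\<And>ij. mat_eval K (poly_deriv K ij P) \<one>\<^bsub>mat_alg K n\<^esub> = \<phi> (d ij)"
    by (rule choice[THEN exE]) blast
  have "(\<Oplus>\<^bsub>K\<^esub>ij\<in>{..<n} \<times> {..<n}.
      mat_eval K (poly_deriv K ij P) \<one>\<^bsub>mat_alg K n\<^esub> \<otimes>\<^bsub>K\<^esub> \<Phi> N $$ ij) =
    \<phi> (\<Sum>ij\<in>{..<n} \<times> {..<n}. d ij * N $$ ij)" if "N \<in> carrier_mat n n" for N
    using that by (intro finsum_K') (auto simp: d)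
  then show ?thesis by blast
qed

lemma lie_algebra_zero: "\<Phi> (0\<^sub>m n n) \<in> lie_algebra K n S"
proof -
  have "(\<Oplus>\<^bsub>K\<^esub>ij\<in>{..<n} \<times> {..<n}.
      mat_eval K (poly_deriv K ij P) \<one>\<^bsub>mat_alg K n\<^esub> \<otimes>\<^bsub>K\<^esub> \<Phi> (0\<^sub>m n n) $$ ij) = \<zero>\<^bsub>K\<^esub>"
    if P: "P \<in> mat_polys K n" for P
  proof -
    obtain d where d: "\<And>N. N \<in> carrier_mat n n \<Longrightarrow> (\<Oplus>\<^bsub>K\<^esub>ij\<in>{..<n} \<times> {..<n}.
      mat_eval K (poly_deriv K ij P) \<one>\<^bsub>mat_alg K n\<^esub> \<otimes>\<^bsub>K\<^esub> \<Phi> N $$ ij) =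
      \<phi> (\<Sum>ij\<in>{..<n} \<times> {..<n}. d ij * N $$ ij)"
      using lie_algebra_linear[OF P] by blast
    have "(\<Sum>ij\<in>{..<n} \<times> {..<n}. d ij * 0\<^sub>m n n $$ ij) = 0"
      by (rule sum.neutral) auto
    then show ?thesis by (simp add: d zero_K)
  qed
  then show ?thesis by (simp add: lie_algebra_def)
qed

lemma lie_algebra_add_smult:
  assumes AB: "\<Phi> A \<in> lie_algebra K n S" "\<Phi> B \<in> lie_algebra K n S"
    and c: "A \<in> carrier_mat n n" "B \<in> carrier_mat n n"
  shows "\<Phi> (A + c \<cdot>\<^sub>m B) \<in> lie_algebra K n S"
proof -
  have "(\<Oplus>\<^bsub>K\<^esub>ij\<in>{..<n} \<times> {..<n}.
      mat_eval K (poly_deriv K ij P) \<one>\<^bsub>mat_alg K n\<^esub> \<otimes>\<^bsub>K\<^esub> \<Phi> (A + c \<cdot>\<^sub>m B) $$ ij) = \<zero>\<^bsub>K\<^esub>"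
    if P: "P \<in> mat_polys K n" "\<forall>g\<in>S. mat_eval K P g = \<zero>\<^bsub>K\<^esub>" for P
  proof -
    obtain d where d: "\<And>N. N \<in> carrier_mat n n \<Longrightarrow> (\<Oplus>\<^bsub>K\<^esub>ij\<in>{..<n} \<times> {..<n}.
      mat_eval K (poly_deriv K ij P) \<one>\<^bsub>mat_alg K n\<^esub> \<otimes>\<^bsub>K\<^esub> \<Phi> N $$ ij) =
      \<phi> (\<Sum>ij\<in>{..<n} \<times> {..<n}. d ij * N $$ ij)"
      using lie_algebra_linear[OF P(1)] by blast
    have "(\<Sum>ij\<in>{..<n} \<times> {..<n}. d ij * (A + c \<cdot>\<^sub>m B) $$ ij) =
      (\<Sum>ij\<in>{..<n} \<times> {..<n}. d ij * A $$ ij + c * (d ij * B $$ ij))"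
      using c by (intro sum.cong) (auto simp: algebra_simps)
    also have "\<dots> = (\<Sum>ij\<in>{..<n} \<times> {..<n}. d ij * A $$ ij) +
        c * (\<Sum>ij\<in>{..<n} \<times> {..<n}. d ij * B $$ ij)"
      by (simp add: sum.distrib sum_distrib_left)
    also have "\<phi> (\<Sum>ij\<in>{..<n} \<times> {..<n}. d ij * A $$ ij) = \<phi> 0"
      using AB(1) P d[OF c(1)] by (simp add: lie_algebra_def zero_K)
    then have "(\<Sum>ij\<in>{..<n} \<times> {..<n}. d ij * A $$ ij) = 0" by simp
    also have "\<phi> (\<Sum>ij\<in>{..<n} \<times> {..<n}. d ij * B $$ ij) = \<phi> 0"
      using AB(2) P d[OF c(2)] by (simp add: lie_algebra_def zero_K)
    then have "(\<Sum>ij\<in>{..<n} \<times> {..<n}. d ij * B $$ ij) = 0" by simp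
    finally show ?thesis using d[of "A + c \<cdot>\<^sub>m B"] c by (simp add: zero_K)
  qed
  with c show ?thesis by (simp add: lie_algebra_def)
qed

end

locale infinite_field_copy = field_copy \<phi> for \<phi> :: "'a::field \<Rightarrow> 'b" +
  assumes infinite_field: "infinite (UNIV :: 'a set)"
begin

text \<open>A polynomial vanishing on \<open>S\<close> vanishes at every point of the line. Over an
  infinite field its restriction is then the zero polynomial, and so the linear coefficient is
  0.\<close>

lemma lie_algebra_line:
  assumes N: "N \<in> carrier_mat n n" and line: "\<And>a. 1\<^sub>m n + a \<cdot>\<^sub>m N \<in> S"
  shows "\<Phi> N \<in> lie_algebra K n (\<Phi> ` S)"
proof -
  have "(\<Oplus>\<^bsub>K\<^esub>ij\<in>{..<n} \<times> {..<n}.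
      mat_eval K (poly_deriv K ij P) \<one>\<^bsub>mat_alg K n\<^esub> \<otimes>\<^bsub>K\<^esub> \<Phi> N $$ ij) = \<zero>\<^bsub>K\<^esub>"
    if P: "P \<in> mat_polys K n" "\<forall>g\<in>\<Phi> ` S. mat_eval K P g = \<zero>\<^bsub>K\<^esub>" for P
  proof -
    obtain p where p: "\<And>a. mat_eval K P (\<Phi> (1\<^sub>m n + a \<cdot>\<^sub>m N)) = \<phi> (poly p a)"
      "(\<Oplus>\<^bsub>K\<^esub>ij\<in>{..<n} \<times> {..<n}.
        mat_eval K (poly_deriv K ij P) \<one>\<^bsub>mat_alg K n\<^esub> \<otimes>\<^bsub>K\<^esub> \<Phi> N $$ ij) = \<phi> (Polynomial.coeff p 1)"
      using mat_poly_on_line[OF P(1) N] by blast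
    have "\<phi> (poly p a) = \<phi> 0" for a
      using p(1) P(2) line by (simp add: zero_K)
    then have "poly p a = 0" for a by simp
    then have "{a. poly p a = 0} = UNIV" by simp
    then have "p = 0" using infinite_field poly_roots_finite[of p] by auto
    with p(2) show ?thesis by (simp add: zero_K)
  qed
  with N show ?thesis by (simp add: lie_algebra_def)
qed

text \<open>Upper bounds for Lie algebras: an equation of the group must have no linear term along a
  tangent vector. The polynomial \<open>q\<close> is any description of \<open>f\<close> on the
  line; over an infinite field it agrees with the one found abstractly.\<close>

lemma lie_algebra_polyfun:
  assumes "\<Phi> N \<in> lie_algebra K n (\<Phi> ` S)" and N: "N \<in> carrier_mat n n"
    and f: "polyfun n f" "\<And>A. A \<in> S \<Longrightarrow> f A = 0" and S: "S \<subseteq> carrier_mat n n"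
    and q: "\<And>a. f (1\<^sub>m n + a \<cdot>\<^sub>m N) = poly q a"
  shows "Polynomial.coeff q 1 = 0"
proof -
  obtain P where P: "P \<in> mat_polys K n" "\<And>A. A \<in> carrier_mat n n \<Longrightarrow> mat_eval K P (\<Phi> A) = \<phi> (f A)"
    using f(1) unfolding polyfun_def by blast
  obtain p where p: "\<And>a. mat_eval K P (\<Phi> (1\<^sub>m n + a \<cdot>\<^sub>m N)) = \<phi> (poly p a)"
    "(\<Oplus>\<^bsub>K\<^esub>ij\<in>{..<n} \<times> {..<n}.
      mat_eval K (poly_deriv K ij P) \<one>\<^bsub>mat_alg K n\<^esub> \<otimes>\<^bsub>K\<^esub> \<Phi> N $$ ij) = \<phi> (Polynomial.coeff p 1)"
    using mat_poly_on_line[OF P(1) N] by blast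
  have "\<phi> (poly p a) = \<phi> (poly q a)" for a
    using P(2)[of "1\<^sub>m n + a \<cdot>\<^sub>m N"] N p(1)[of a] q[of a] by simp
  then have "{a. poly (p - q) a = 0} = UNIV" by simp
  then have "p - q = 0" using infinite_field poly_roots_finite[of "p - q"] by auto
  moreover have "\<forall>g\<in>\<Phi> ` S. mat_eval K P g = \<zero>\<^bsub>K\<^esub>"
    using P(2) f(2) S by (auto simp: zero_K)
  then have "\<phi> (Polynomial.coeff p 1) = \<phi> 0"
    using assms(1) P(1) p(2) by (simp add: lie_algebra_def zero_K)
  ultimately show ?thesis by simp
qed

end

section \<open>The symplectic group\<close>

text \<open>In terms of a symplectic basis \<open>e, f\<close> of \<open>k\<^sup>2\<close>, the basis vectors 0, ..., 5 of \<open>V\<close> are \<open>e \<otimes> 1\<close>,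
  \<open>e \<otimes> n\<close>, \<open>f \<otimes> 1\<close>, \<open>f \<otimes> n\<close> and the two basis vectors of \<open>k\<^sup>2 \<otimes> R/n\<close>. The form pairs \<open>i\<close> with \<open>\<sigma> i\<close>.
  All signs are dropped, so that \<open>Sp6\<close> is the symplectic group only in characteristic 2.\<close>

definition \<sigma> :: "nat \<Rightarrow> nat" where
  "\<sigma> i = (if i < 4 then 3 - i else 9 - i)"

lemma less_6: "(i::nat) < 6 \<longleftrightarrow> i = 0 \<or> i = 1 \<or> i = 2 \<or> i = 3 \<or> i = 4 \<or> i = 5"
  by arith

lemma \<sigma>_less [simp]: "i < 6 \<Longrightarrow> \<sigma> i < 6"
  by (auto simp: \<sigma>_def)

lemma \<sigma>_\<sigma> [simp]: "i < 6 \<Longrightarrow> \<sigma> (\<sigma> i) = i"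
  by (auto simp: \<sigma>_def)

lemma \<sigma>_neq [simp]: "i < 6 \<Longrightarrow> \<sigma> i \<noteq> i"
  by (auto simp: less_6 \<sigma>_def)

lemma \<sigma>_block [simp]: "i < 6 \<Longrightarrow> \<sigma> i < 4 \<longleftrightarrow> i < 4"
  by (auto simp: \<sigma>_def)

lemma \<sigma>_eq_iff: "i < 6 \<Longrightarrow> j < 6 \<Longrightarrow> \<sigma> i = j \<longleftrightarrow> i = \<sigma> j"
  by auto

lemma sum_6: "(\<Sum>l<6::nat. f l) = f 0 + f 1 + f 2 + f 3 + f 4 + f 5"
  by (simp add: numeral_eq_Suc)

lemma sum_\<sigma>: "(\<Sum>l<6. f (\<sigma> l)) = (\<Sum>l<6. f l)"
  by (rule sum.reindex_bij_witness[of _ \<sigma> \<sigma>]) auto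

lemma mult_mat_entry:
  assumes "A \<in> carrier_mat n n" "B \<in> carrier_mat n n" "i < n" "j < n"
  shows "(A * B) $$ (i, j) = (\<Sum>l<n. A $$ (i, l) * B $$ (l, j))"
  using assms by (auto simp: scalar_prod_def atLeast0LessThan)

lemma mult_carrier_6 [simp]:
  "A \<in> carrier_mat 6 6 \<Longrightarrow> B \<in> carrier_mat 6 6 \<Longrightarrow> A * B \<in> carrier_mat 6 6"
  by (rule mult_carrier_mat)

lemmas assoc_6 = assoc_mult_mat[of _ 6 6 _ 6 _ 6]

definition gram :: "'a::field mat" where
  "gram = mat 6 6 (\<lambda>(i, j). if j = \<sigma> i then 1 else 0)"

lemma gram_carrier [simp]: "gram \<in> carrier_mat 6 6"
  by (simp add: gram_def)

lemma gram_entry: "i < 6 \<Longrightarrow> j < 6 \<Longrightarrow> gram $$ (i, j) = (if j = \<sigma> i then 1 else 0)"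
  by (simp add: gram_def)

lemma mult_gram_entry:
  assumes "A \<in> carrier_mat 6 6" "i < 6" "j < 6"
  shows "(A * gram) $$ (i, j) = A $$ (i, \<sigma> j)" "(gram * A) $$ (i, j) = A $$ (\<sigma> i, j)"
proof -
  have "(A * gram) $$ (i, j) = (\<Sum>l<6. if l = \<sigma> j then A $$ (i, l) else 0)"
    unfolding mult_mat_entry[OF assms(1) gram_carrier assms(2,3)]
    using assms by (intro sum.cong) (auto simp: gram_def)
  then show "(A * gram) $$ (i, j) = A $$ (i, \<sigma> j)" using assms by simp
  have "(gram * A) $$ (i, j) = (\<Sum>l<6. if l = \<sigma> i then A $$ (l, j) else 0)"
    unfolding mult_mat_entry[OF gram_carrier assms(1) assms(2,3)]
    using assms by (intro sum.cong) (auto simp: gram_def)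
  then show "(gram * A) $$ (i, j) = A $$ (\<sigma> i, j)" using assms by simp
qed

lemma gram_gram [simp]: "gram * gram = 1\<^sub>m 6"
proof (rule eq_matI)
  fix i j assume "i < dim_row (1\<^sub>m 6 :: 'a mat)" "j < dim_col (1\<^sub>m 6 :: 'a mat)"
  then show "(gram * gram :: 'a mat) $$ (i, j) = 1\<^sub>m 6 $$ (i, j)"
    by (simp add: mult_gram_entry(1)[OF gram_carrier]) (auto simp: gram_entry \<sigma>_eq_iff)
qed (auto simp: gram_def)

lemma gram_transpose [simp]: "transpose_mat gram = gram"
  by (rule eq_matI) (auto simp: gram_def)

definition Sp6 :: "'a::field mat set" where
  "Sp6 = {A \<in> carrier_mat 6 6. transpose_mat A * gram * A = gram}"

lemma Sp6_carrier: "A \<in> Sp6 \<Longrightarrow> A \<in> carrier_mat 6 6"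
  by (simp add: Sp6_def)

lemma form_entry:
  assumes "A \<in> carrier_mat 6 6" "i < 6" "j < 6"
  shows "(transpose_mat A * gram * A) $$ (i, j) = (\<Sum>l<6. A $$ (l, i) * A $$ (\<sigma> l, j))"
proof -
  have "(transpose_mat A * gram * A) $$ (i, j) = (\<Sum>l<6. (transpose_mat A * gram) $$ (i, l) * A $$ (l, j))"
    using assms by (intro mult_mat_entry) auto
  also have "\<dots> = (\<Sum>l<6. A $$ (\<sigma> l, i) * A $$ (l, j))"
    using assms by (intro sum.cong) (auto simp: mult_gram_entry(1)[of "transpose_mat A"])
  also have "\<dots> = (\<Sum>l<6. A $$ (\<sigma> (\<sigma> l), i) * A $$ (\<sigma> l, j))"
    by (rule sum_\<sigma>[symmetric])
  finally show ?thesis by simp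
qed

lemma Sp6_iff:
  "A \<in> Sp6 \<longleftrightarrow> A \<in> carrier_mat 6 6 \<and>
    (\<forall>i<6. \<forall>j<6. (\<Sum>l<6. A $$ (l, i) * A $$ (\<sigma> l, j)) = (if j = \<sigma> i then 1 else 0))"
proof (cases "A \<in> carrier_mat 6 6")
  case True
  then have "transpose_mat A * gram * A = gram \<longleftrightarrow>
      (\<forall>i<6. \<forall>j<6. (transpose_mat A * gram * A) $$ (i, j) = gram $$ (i, j))"
    by (auto simp: mat_eq_iff gram_def)
  also have "\<dots> \<longleftrightarrow> (\<forall>i<6. \<forall>j<6. (\<Sum>l<6. A $$ (l, i) * A $$ (\<sigma> l, j)) = (if j = \<sigma> i then 1 else 0))"
    by (intro all_cong1 imp_cong refl) (simp add: form_entry[OF True] gram_entry)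
  finally show ?thesis using True by (simp add: Sp6_def)
qed (simp add: Sp6_def)

text \<open>\<open>gram\<close> is its own inverse, so multiplying the defining equation by it
  exhibits a left inverse, and for square matrices a left inverse is two-sided.\<close>

lemma Sp6_inverse:
  assumes "A \<in> Sp6"
  shows "gram * transpose_mat A * gram * A = 1\<^sub>m 6" "A * (gram * transpose_mat A * gram) = 1\<^sub>m 6"
    "gram * transpose_mat A * gram \<in> Sp6"
proof -
  let ?B = "gram * transpose_mat A * gram"
  have A: "A \<in> carrier_mat 6 6" "transpose_mat A * gram * A = gram"
    using assms by (auto simp: Sp6_def)
  have "?B * A = gram * (transpose_mat A * gram * A)"
    using A(1) by (simp add: assoc_6)
  then show BA: "?B * A = 1\<^sub>m 6" by (simp add: A(2))
  then show AB: "A * ?B = 1\<^sub>m 6"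
    using A(1) by (intro mat_mult_left_right_inverse[of ?B 6 A]) auto
  have "transpose_mat ?B = gram * A * gram"
    using A(1) by (simp add: transpose_mult[where nr = 6 and n = 6 and nc = 6]
        assoc_6)
  then have "transpose_mat ?B * gram * ?B = gram * A * (gram * gram) * ?B"
    using A(1) by (simp add: assoc_6)
  also have "\<dots> = gram * (A * ?B)"
    using A(1) by (simp add: assoc_6)
  finally show "?B \<in> Sp6"
    using A(1) by (simp add: AB Sp6_def right_mult_one_mat[OF gram_carrier])
qed

lemma Sp6_mult:
  assumes "A \<in> Sp6" "B \<in> Sp6"
  shows "A * B \<in> Sp6"
proof -
  have c: "A \<in> carrier_mat 6 6" "B \<in> carrier_mat 6 6" using assms by (auto simp: Sp6_def)
  have "transpose_mat (A * B) * gram * (A * B) = transpose_mat B * (transpose_mat A * gram * A) * B"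
    using c by (simp add: transpose_mult[where nr = 6 and n = 6 and nc = 6]
        assoc_6)
  then show ?thesis using assms c by (simp add: Sp6_def)
qed

lemma matrix_group_Sp6: "matrix_group 6 Sp6"
  unfolding matrix_group_def
proof (intro conjI ballI)
  show "\<exists>B\<in>Sp6. A * B = 1\<^sub>m 6 \<and> B * A = 1\<^sub>m 6" if "A \<in> Sp6" for A
    using Sp6_inverse[OF that] by blast
  show "1\<^sub>m 6 \<in> Sp6"
    by (simp add: Sp6_def right_mult_one_mat[OF gram_carrier] left_mult_one_mat[OF gram_carrier])
qed (auto intro: Sp6_mult Sp6_carrier)

section \<open>The stabiliser of the decomposition\<close>

definition proj :: "'a::field mat" where
  "proj = mat 6 6 (\<lambda>(i, j). if i = j \<and> i < 4 then 1 else 0)"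

lemma proj_carrier [simp]: "proj \<in> carrier_mat 6 6"
  by (simp add: proj_def)

lemma mult_proj_entry:
  assumes "A \<in> carrier_mat 6 6" "i < 6" "j < 6"
  shows "(A * proj) $$ (i, j) = (if j < 4 then A $$ (i, j) else 0)"
    "(proj * A) $$ (i, j) = (if i < 4 then A $$ (i, j) else 0)"
proof -
  have "(A * proj) $$ (i, j) = (\<Sum>l<6. if l = j then (if j < 4 then A $$ (i, l) else 0) else 0)"
    unfolding mult_mat_entry[OF assms(1) proj_carrier assms(2,3)]
    using assms by (intro sum.cong) (auto simp: proj_def)
  then show "(A * proj) $$ (i, j) = (if j < 4 then A $$ (i, j) else 0)" using assms by simp
  have "(proj * A) $$ (i, j) = (\<Sum>l<6. if l = i then (if i < 4 then A $$ (l, j) else 0) else 0)"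
    unfolding mult_mat_entry[OF proj_carrier assms(1) assms(2,3)]
    using assms by (intro sum.cong) (auto simp: proj_def)
  then show "(proj * A) $$ (i, j) = (if i < 4 then A $$ (i, j) else 0)" using assms by simp
qed

lemma commute_proj_iff:
  assumes "A \<in> carrier_mat 6 6"
  shows "proj * A = A * proj \<longleftrightarrow> (\<forall>i<6. \<forall>j<6. (i < 4) \<noteq> (j < 4) \<longrightarrow> A $$ (i, j) = 0)"
proof -
  have "proj * A = A * proj \<longleftrightarrow> (\<forall>i<6. \<forall>j<6. (proj * A) $$ (i, j) = (A * proj) $$ (i, j))"
    using assms by (auto simp: mat_eq_iff proj_def)
  also have "\<dots> \<longleftrightarrow> (\<forall>i<6. \<forall>j<6. (i < 4) \<noteq> (j < 4) \<longrightarrow> A $$ (i, j) = 0)"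
    by (intro all_cong1 imp_cong refl) (auto simp: mult_proj_entry[OF assms])
  finally show ?thesis .
qed

text \<open>A matrix preserves both summands exactly when it commutes with the projection onto one
  along the other. In this form closure under products and inverses is plain algebra.\<close>

definition Sp42 :: "'a::field mat set" where
  "Sp42 = {A \<in> Sp6. proj * A = A * proj}"

lemma matrix_group_Sp42: "matrix_group 6 Sp42"
  unfolding matrix_group_def
proof (intro conjI ballI)
  show "Sp42 \<subseteq> carrier_mat 6 6" "1\<^sub>m 6 \<in> Sp42"
    using matrix_group_Sp6
    by (auto simp: matrix_group_def Sp42_def left_mult_one_mat[OF proj_carrier] right_mult_one_mat[OF proj_carrier])
  fix A :: "'a mat" assume A: "A \<in> Sp42"
  then have c: "A \<in> carrier_mat 6 6" "proj * A = A * proj" by (auto simp: Sp42_def Sp6_def)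
  {
    fix B :: "'a mat" assume B: "B \<in> Sp42"
    then have d: "B \<in> carrier_mat 6 6" "proj * B = B * proj" by (auto simp: Sp42_def Sp6_def)
    have "proj * (A * B) = A * proj * B" using c d by (simp flip: assoc_6)
    also have "\<dots> = A * B * proj" using c d by (simp add: assoc_6)
    finally show "A * B \<in> Sp42" using A B Sp6_mult[of A B] by (simp add: Sp42_def)
  }
  let ?B = "gram * transpose_mat A * gram"
  have AS: "A \<in> Sp6" using A by (simp add: Sp42_def)
  note B = Sp6_inverse[OF AS]
  have d: "?B \<in> carrier_mat 6 6" using B(3) by (rule Sp6_carrier)
  have "proj * ?B = ?B * A * proj * ?B" using B(1) by (simp only: left_mult_one_mat[OF proj_carrier])
  also have "\<dots> = ?B * (proj * A) * ?B" using c d by (simp add: assoc_6)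
  also have "\<dots> = ?B * proj * (A * ?B)" using c(1) d by (simp add: assoc_6)
  also have "\<dots> = ?B * proj" unfolding B(2) by (rule right_mult_one_mat[where nr = 6]) (simp add: d)
  finally show "\<exists>B\<in>Sp42. A * B = 1\<^sub>m 6 \<and> B * A = 1\<^sub>m 6"
    using B by (intro bexI[of _ ?B]) (auto simp: Sp42_def)
qed

section \<open>Symplectic transvections in characteristic 2\<close>

locale char2_copy = infinite_field_copy \<phi> for \<phi> :: "'a::field \<Rightarrow> 'b" +
  assumes char_2: "(1::'a) + 1 = 0"
begin

text \<open>As simp rules, these facts remove all signs and cancel equal summands, so that the
  simplifier can settle identities in characteristic 2.\<close>

lemma add_self [simp]: "x + x = (0::'a)"
proof -
  have "x + x = x * (1 + 1)" by (simp only: distrib_left mult_1_right)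
  then show ?thesis by (simp only: char_2 mult_zero_right)
qed

lemma two_eq_0 [simp]: "2 = (0::'a)"
  by (simp only: char_2 flip: one_add_one)

lemma add_left_self [simp]: "x + (x + y) = (y::'a)"
  by (simp flip: add.assoc)

lemma uminus_eq [simp]: "- x = (x::'a)"
  by (rule minus_unique) simp

lemma minus_eq [simp]: "x - y = (x + y :: 'a)"
  by (simp add: diff_conv_add_uminus del: add_uminus_conv_diff)

lemma add_eq_0_iff_eq [simp]: "x + y = 0 \<longleftrightarrow> x = (y::'a)"
  by (simp add: add_eq_0_iff2)

lemma square_eq_1 [simp]: "x * x = 1 \<longleftrightarrow> x = (1::'a)"
  using square_eq_1_iff[of x] by auto

definition transv_dir :: "(nat \<Rightarrow> 'a) \<Rightarrow> 'a mat" where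
  "transv_dir w = mat 6 6 (\<lambda>(i, j). w i * w (\<sigma> j))"

text \<open>The symplectic transvection taking v to v + a <w, v> w, where <w, v> is the sum of the w
  (\<open>\<sigma>\<close> l) v l. For fixed \<open>w\<close> these matrices form a line through the
  identity, which later yields tangent vectors.\<close>

definition transv :: "'a \<Rightarrow> (nat \<Rightarrow> 'a) \<Rightarrow> 'a mat" where
  "transv a w = 1\<^sub>m 6 + a \<cdot>\<^sub>m transv_dir w"

lemma transv_carrier [simp]: "transv_dir w \<in> carrier_mat 6 6" "transv a w \<in> carrier_mat 6 6"
  by (auto simp: transv_dir_def transv_def)

lemma transv_dim [simp]: "dim_row (transv a w) = 6" "dim_col (transv a w) = 6"
  by (simp_all add: transv_def transv_dir_def)

lemma transv_entry:
  "i < 6 \<Longrightarrow> j < 6 \<Longrightarrow> transv a w $$ (i, j) = (if i = j then 1 else 0) + a * (w i * w (\<sigma> j))"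
  by (simp add: transv_def transv_dir_def)

text \<open>Each pair l, \<open>\<sigma>\<close> l contributes the same product twice.\<close>

lemma sum_isotropic: "(\<Sum>l<6. w l * w (\<sigma> l)) = (0::'a)"
  by (simp add: sum_6 \<sigma>_def ac_simps)

lemma sum_delta:
  fixes i :: nat
  shows
  "i < 6 \<Longrightarrow> (\<Sum>l<6. (if i = l then 1 else 0) * f l) = (f i :: 'a)"
  "i < 6 \<Longrightarrow> (\<Sum>l<6. (if l = i then 1 else 0) * f l) = (f i :: 'a)"
  "i < 6 \<Longrightarrow> (\<Sum>l<6. f l * (if i = l then 1 else 0)) = (f i :: 'a)"
  "i < 6 \<Longrightarrow> (\<Sum>l<6. f l * (if l = i then 1 else 0)) = (f i :: 'a)"
  by (simp_all add: if_distrib[of "\<lambda>x. x * _"] if_distrib[of "\<lambda>x. _ * x"] cong: if_cong)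

lemma transv_Sp6: "transv a w \<in> Sp6"
  unfolding Sp6_iff
proof (intro conjI allI impI)
  fix i j :: nat assume ij: "i < 6" "j < 6"
  have "(\<Sum>l<6. transv a w $$ (l, i) * transv a w $$ (\<sigma> l, j)) =
    (\<Sum>l<6. (if l = i then 1 else 0) * (if \<sigma> l = j then 1 else 0) +
      (if l = i then 1 else 0) * (a * (w (\<sigma> l) * w (\<sigma> j))) +
      (a * (w l * w (\<sigma> i))) * (if l = \<sigma> j then 1 else 0) +
      a * a * w (\<sigma> i) * w (\<sigma> j) * (w l * w (\<sigma> l)))"
    using ij by (intro sum.cong refl) (auto simp: transv_entry algebra_simps \<sigma>_eq_iff)
  also have "\<dots> = (if \<sigma> i = j then 1 else 0) + a * (w (\<sigma> i) * w (\<sigma> j)) + a * (w (\<sigma> j) * w (\<sigma> i)) +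
      a * a * w (\<sigma> i) * w (\<sigma> j) * (\<Sum>l<6. w l * w (\<sigma> l))"
    using ij by (simp only: sum.distrib sum_delta \<sigma>_less sum_distrib_left)
  also have "\<dots> = (if j = \<sigma> i then 1 else 0)"
    unfolding sum_isotropic by (simp add: ac_simps)
  finally show "(\<Sum>l<6. transv a w $$ (l, i) * transv a w $$ (\<sigma> l, j)) = (if j = \<sigma> i then 1 else 0)" .
qed simp

lemma transv_square: "transv a w * transv a w = 1\<^sub>m 6"
proof (rule eq_matI)
  fix i j assume "i < dim_row (1\<^sub>m 6 :: 'a mat)" "j < dim_col (1\<^sub>m 6 :: 'a mat)"
  then have ij: "i < 6" "j < 6" by auto
  have "(transv a w * transv a w) $$ (i, j) =
    (\<Sum>l<6. (if i = l then 1 else 0) * (if l = j then 1 else 0) +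
      (if i = l then 1 else 0) * (a * (w l * w (\<sigma> j))) +
      (a * (w i * w (\<sigma> l))) * (if l = j then 1 else 0) +
      a * a * w i * w (\<sigma> j) * (w l * w (\<sigma> l)))"
    unfolding mult_mat_entry[OF transv_carrier(2) transv_carrier(2) ij]
    using ij by (intro sum.cong refl) (auto simp: transv_entry algebra_simps)
  also have "\<dots> = (if i = j then 1 else 0) + a * (w i * w (\<sigma> j)) + a * (w i * w (\<sigma> j)) +
      a * a * w i * w (\<sigma> j) * (\<Sum>l<6. w l * w (\<sigma> l))"
    using ij by (simp only: sum.distrib sum_delta sum_distrib_left)
  also have "\<dots> = 1\<^sub>m 6 $$ (i, j)"
    unfolding sum_isotropic using ij by simp
  finally show "(transv a w * transv a w) $$ (i, j) = 1\<^sub>m 6 $$ (i, j)" .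
qed (auto simp: transv_def transv_dir_def)

text \<open>Conjugating the transvection along w by an isometry u gives the one along u w.\<close>

lemma transv_conj:
  assumes u: "u \<in> Sp6" and u': "u' \<in> carrier_mat 6 6" "u * u' = 1\<^sub>m 6"
  shows "u * transv a w * u' = transv a (\<lambda>i. \<Sum>l<6. u $$ (i, l) * w l)"
proof -
  let ?w = "\<lambda>i. \<Sum>l<6. u $$ (i, l) * w l"
  have c: "u \<in> carrier_mat 6 6" using u by (rule Sp6_carrier)
  \<comment> \<open>In coordinates: <u w, u e_j> = <w, e_j>.\<close>
  have pres: "(\<Sum>l<6. ?w (\<sigma> l) * u $$ (l, j)) = w (\<sigma> j)" if j: "j < 6" for j
  proof -
    have "(\<Sum>l<6. ?w (\<sigma> l) * u $$ (l, j)) = (\<Sum>l<6. \<Sum>m<6. w m * (u $$ (l, j) * u $$ (\<sigma> l, m)))"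
      by (simp add: sum_distrib_left sum_distrib_right ac_simps)
    also have "\<dots> = (\<Sum>m<6. w m * (\<Sum>l<6. u $$ (l, j) * u $$ (\<sigma> l, m)))"
      by (subst sum.swap) (simp add: sum_distrib_left)
    also have "\<dots> = (\<Sum>m<6. w m * (if m = \<sigma> j then 1 else 0))"
      using u j by (intro sum.cong refl) (simp add: Sp6_iff)
    also have "\<dots> = w (\<sigma> j)"
      using j by (simp only: sum_delta \<sigma>_less)
    finally show ?thesis .
  qed
  have eq: "u * transv a w = transv a ?w * u"
  proof (rule eq_matI)
    fix i j assume "i < dim_row (transv a ?w * u)" "j < dim_col (transv a ?w * u)"
    then have ij: "i < 6" "j < 6" using c by (auto simp: transv_def transv_dir_def)
    have "(u * transv a w) $$ (i, j) =
      (\<Sum>l<6. u $$ (i, l) * (if l = j then 1 else 0) + a * w (\<sigma> j) * (u $$ (i, l) * w l))"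
      unfolding mult_mat_entry[OF c transv_carrier(2) ij]
      using ij by (intro sum.cong refl) (auto simp: transv_entry algebra_simps)
    also have "\<dots> = u $$ (i, j) + a * w (\<sigma> j) * ?w i"
      using ij by (simp only: sum.distrib sum_delta sum_distrib_left)
    also have "\<dots> = u $$ (i, j) + a * ?w i * w (\<sigma> j)"
      by (simp only: ac_simps)
    also have "\<dots> = u $$ (i, j) + a * ?w i * (\<Sum>l<6. ?w (\<sigma> l) * u $$ (l, j))"
      by (simp only: pres[OF ij(2)])
    also have "\<dots> = (\<Sum>l<6. (if i = l then 1 else 0) * u $$ (l, j) + a * ?w i * (?w (\<sigma> l) * u $$ (l, j)))"
      using ij by (simp only: sum.distrib sum_delta sum_distrib_left)
    also have "\<dots> = (transv a ?w * u) $$ (i, j)"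
      unfolding mult_mat_entry[OF transv_carrier(2) c ij]
      using ij by (intro sum.cong refl) (simp add: transv_entry distrib_right mult.assoc)
    finally show "(u * transv a w) $$ (i, j) = (transv a ?w * u) $$ (i, j)" .
  qed (use c in \<open>auto simp: transv_def transv_dir_def\<close>)
  have "u * transv a w * u' = transv a ?w * (u * u')"
    using c u'(1) by (simp add: eq assoc_6)
  then show ?thesis
    by (simp add: u'(2) right_mult_one_mat[OF transv_carrier(2)])
qed

abbreviation unit_fun :: "nat \<Rightarrow> nat \<Rightarrow> 'a" where
  "unit_fun i \<equiv> (\<lambda>l. if l = i then 1 else 0)"

text \<open>On the span of \<open>e\<close> and \<open>w\<close> the matrix \<open>Z\<close> acts by
  an invertible matrix with entries 1, 1, 1, 0, so all its powers are injective there.\<close>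

lemma not_nilpotent:
  fixes Z :: "'a mat"
  assumes Z: "Z \<in> carrier_mat n n" and e: "e \<in> carrier_vec n" "w \<in> carrier_vec n"
    and Ze: "Z *\<^sub>v e = e + w" and Zw: "Z *\<^sub>v w = e"
    and indep: "\<And>p q. p \<cdot>\<^sub>v e + q \<cdot>\<^sub>v w = 0\<^sub>v n \<Longrightarrow> p = 0 \<and> q = 0"
  shows "Z ^\<^sub>m m \<noteq> 0\<^sub>m n n"
proof -
  have *: "p = 0 \<and> q = 0" if "Z ^\<^sub>m m *\<^sub>v (p \<cdot>\<^sub>v e + q \<cdot>\<^sub>v w) = 0\<^sub>v n" for p q
    using that
  proof (induction m arbitrary: p q)
    case 0
    then show ?case using indep Z e by simp
  next
    case (Suc m)
    have "Z *\<^sub>v (p \<cdot>\<^sub>v e + q \<cdot>\<^sub>v w) = p \<cdot>\<^sub>v (e + w) + q \<cdot>\<^sub>v e"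
      using Z e by (simp add: mult_add_distrib_mat_vec[of Z n n] mult_mat_vec[of Z n n] Ze Zw)
    also have "\<dots> = (p + q) \<cdot>\<^sub>v e + p \<cdot>\<^sub>v w"
      using e by (intro eq_vecI) (auto simp: algebra_simps)
    finally have "Z ^\<^sub>m m *\<^sub>v ((p + q) \<cdot>\<^sub>v e + p \<cdot>\<^sub>v w) = 0\<^sub>v n"
      using Suc.prems Z e by (simp add: assoc_mult_mat_vec[of _ n n _ n])
    from Suc.IH[OF this] show ?case by auto
  qed
  show ?thesis
  proof
    assume "Z ^\<^sub>m m = 0\<^sub>m n n"
    then have "Z ^\<^sub>m m *\<^sub>v (1 \<cdot>\<^sub>v e + 0 \<cdot>\<^sub>v w) = 0\<^sub>v n"
      using e by auto
    from *[OF this] show False by simp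
  qed
qed

lemma transv_mult_entry:
  assumes "A \<in> carrier_mat 6 6" "i < 6" "j < 6"
  shows "(transv a w * A) $$ (i, j) = A $$ (i, j) + a * w i * (\<Sum>l<6. w (\<sigma> l) * A $$ (l, j))"
proof -
  have "(transv a w * A) $$ (i, j) =
      (\<Sum>l<6. (if i = l then 1 else 0) * A $$ (l, j) + a * w i * (w (\<sigma> l) * A $$ (l, j)))"
    unfolding mult_mat_entry[OF transv_carrier(2) assms]
    using assms by (intro sum.cong refl) (simp add: transv_entry distrib_right mult.assoc)
  also have "\<dots> = A $$ (i, j) + a * w i * (\<Sum>l<6. w (\<sigma> l) * A $$ (l, j))"
    using assms by (simp only: sum.distrib sum_delta sum_distrib_left)
  finally show ?thesis .
qed

lemma transv_mult_vec:
  assumes "v \<in> carrier_vec 6" "i < 6"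
  shows "(transv a w *\<^sub>v v) $ i = v $ i + a * w i * (\<Sum>l<6. w (\<sigma> l) * v $ l)"
proof -
  have "(transv a w *\<^sub>v v) $ i = (\<Sum>l<6. transv a w $$ (i, l) * v $ l)"
    using assms by (auto simp: scalar_prod_def atLeast0LessThan)
  also have "\<dots> = (\<Sum>l<6. (if i = l then 1 else 0) * v $ l + a * w i * (w (\<sigma> l) * v $ l))"
    using assms by (intro sum.cong refl) (simp add: transv_entry distrib_right mult.assoc)
  also have "\<dots> = v $ i + a * w i * (\<Sum>l<6. w (\<sigma> l) * v $ l)"
    using assms by (simp only: sum.distrib sum_delta sum_distrib_left)
  finally show ?thesis .
qed

lemma sum_unit_\<sigma>: "i < 6 \<Longrightarrow> (\<Sum>l<6. unit_fun i (\<sigma> l) * f l) = f (\<sigma> i)"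
proof -
  assume i: "i < 6"
  have "(\<Sum>l<6. unit_fun i (\<sigma> l) * f l) = (\<Sum>l<6. unit_fun (\<sigma> i) l * f l)"
    using i by (intro sum.cong refl) (auto simp: \<sigma>_eq_iff)
  then show ?thesis using i by (simp only: sum_delta \<sigma>_less)
qed

text \<open>If \<open>u\<close> lies in the normal unipotent subgroup, then so does the commutator of \<open>u\<close> with the
  transvection along \<open>e\<^sub>i\<close>, a product of the transvections along \<open>e\<^sub>i\<close> and \<open>u e\<^sub>i\<close>. If these vectors are
  not orthogonal, a suitable scaling makes it an element of order 3 on their span. So they are
  orthogonal; applied to the commutators themselves, this gives \<open>u e\<^sub>i = e\<^sub>i\<close>.\<close>

lemma normal_unipotent_trivial:
  assumes S: "S \<subseteq> Sp6"
    and transv: "\<And>a i. i < 6 \<Longrightarrow> transv a (unit_fun i) \<in> S"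
    and U: "U \<subseteq> S" "matrix_group 6 U"
    and normal: "\<And>A B u. A \<in> S \<Longrightarrow> B \<in> S \<Longrightarrow> A * B = 1\<^sub>m 6 \<Longrightarrow> B * A = 1\<^sub>m 6 \<Longrightarrow> u \<in> U \<Longrightarrow> A * u * B \<in> U"
    and unip: "\<And>u. u \<in> U \<Longrightarrow> \<exists>m. (u - 1\<^sub>m 6) ^\<^sub>m m = 0\<^sub>m 6 6"
  shows "U \<subseteq> {1\<^sub>m 6}"
proof
  have D: "transv a (unit_fun i) * transv a (\<lambda>x. u $$ (x, i)) \<in> U"
    if u: "u \<in> U" and i: "i < 6" for u a i
  proof -
    let ?T = "transv a (unit_fun i)"
    obtain u' where u': "u' \<in> U" "u * u' = 1\<^sub>m 6"
      using U(2) u unfolding matrix_group_def by blast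
    have c: "u \<in> carrier_mat 6 6" "u' \<in> carrier_mat 6 6"
      using u u' U(2) unfolding matrix_group_def by blast+
    have "?T * u * ?T \<in> U"
      using transv[OF i] transv[OF i] transv_square transv_square u by (rule normal)
    then have "?T * u * ?T * u' \<in> U"
      using u' U(2) unfolding matrix_group_def by blast
    also have "?T * u * ?T * u' = ?T * (u * ?T * u')"
      using c by (simp add: assoc_6)
    also have "u * ?T * u' = transv a (\<lambda>x. u $$ (x, i))"
      using transv_conj[of u u' a "unit_fun i"] u u' c S U(1) i by (auto simp: sum_delta)
    finally show ?thesis .
  qed
  \<comment> \<open>The entry is <e_i, u e_i>, so this is the orthogonality of e_i and u
    e_i.\<close>
  have diag: "u $$ (\<sigma> i, i) = 0" if u: "u \<in> U" and i: "i < 6" for u i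
  proof (rule ccontr)
    assume nz: "u $$ (\<sigma> i, i) \<noteq> 0"
    \<comment> \<open>With this scaling the commutator sends e to w and w to w + e, where w = u
      e.\<close>
    define a where "a = inverse (u $$ (\<sigma> i, i))"
    have a: "a * u $$ (\<sigma> i, i) = 1" using nz by (simp add: a_def)
    let ?T = "transv a (unit_fun i)" and ?N = "transv a (\<lambda>x. u $$ (x, i))"
    define e :: "'a vec" where "e = vec 6 (unit_fun i)"
    define w where "w = vec 6 (\<lambda>x. u $$ (x, i))"
    have ew: "e \<in> carrier_vec 6" "w \<in> carrier_vec 6" by (auto simp: e_def w_def)
    have "(\<Sum>l<6. u $$ (\<sigma> l, i) * e $ l) = u $$ (\<sigma> i, i)"
      using i by (subst sum_delta(4)[symmetric, of i]) (auto simp: e_def intro!: sum.cong)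
    then have Ne: "?N *\<^sub>v e = e + w"
    proof (intro eq_vecI)
      fix x assume "x < dim_vec (e + w)"
      then have x: "x < 6" by (simp add: w_def)
      have "(?N *\<^sub>v e) $ x = e $ x + a * u $$ (x, i) * u $$ (\<sigma> i, i)"
        unfolding transv_mult_vec[OF ew(1) x]
        by (simp only: \<open>(\<Sum>l<6. u $$ (\<sigma> l, i) * e $ l) = u $$ (\<sigma> i, i)\<close>)
      also have "\<dots> = e $ x + u $$ (x, i) * (a * u $$ (\<sigma> i, i))"
        by (simp only: ac_simps)
      finally show "(?N *\<^sub>v e) $ x = (e + w) $ x"
        using x ew by (simp add: a w_def)
    qed (simp add: w_def)
    have Nw: "?N *\<^sub>v w = w"
    proof (intro eq_vecI)
      fix x assume "x < dim_vec w"
      then have x: "x < 6" by (simp add: w_def)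
      have "(\<Sum>l<6. u $$ (\<sigma> l, i) * w $ l) = (\<Sum>l<6. u $$ (l, i) * u $$ (\<sigma> l, i))"
        by (intro sum.cong refl) (auto simp: w_def ac_simps)
      also have "\<dots> = 0" by (rule sum_isotropic)
      finally show "(?N *\<^sub>v w) $ x = w $ x" using x ew by (simp add: transv_mult_vec del: index_mult_mat_vec)
    qed (auto simp: w_def transv_def transv_dir_def)
    have T: "(?T *\<^sub>v v) $ x = v $ x + a * unit_fun i x * v $ \<sigma> i" if "v \<in> carrier_vec 6" "x < 6" for v x
      using that i by (simp only: transv_mult_vec sum_unit_\<sigma>)
    have De: "(?T * ?N) *\<^sub>v e = w"
    proof -
      have "?T *\<^sub>v (e + w) = w"
        using i ew a by (intro eq_vecI) (auto simp: T e_def w_def simp del: index_mult_mat_vec)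
      then show ?thesis using ew Ne by (simp add: assoc_mult_mat_vec[of _ 6 6 _ 6])
    qed
    have Dw: "(?T * ?N) *\<^sub>v w = w + e"
    proof -
      have "?T *\<^sub>v w = w + e"
        using i ew a by (intro eq_vecI) (auto simp: T e_def w_def simp del: index_mult_mat_vec)
      then show ?thesis using ew Nw by (simp add: assoc_mult_mat_vec[of _ 6 6 _ 6])
    qed
    let ?Z = "?T * ?N - 1\<^sub>m 6"
    have sub: "?Z *\<^sub>v v = (?T * ?N) *\<^sub>v v - v" if "v \<in> carrier_vec 6" for v
      using that minus_mult_distrib_mat_vec[of "?T * ?N" 6 6 "1\<^sub>m 6" v] by simp
    have "?Z ^\<^sub>m m \<noteq> 0\<^sub>m 6 6" for m
    proof (rule not_nilpotent)
      show "?Z \<in> carrier_mat 6 6" by (simp add: minus_carrier_mat)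
      show "?Z *\<^sub>v e = e + w"
        unfolding sub[OF ew(1)] De using ew by (intro eq_vecI) (auto simp: add.commute)
      show "?Z *\<^sub>v w = e"
        unfolding sub[OF ew(2)] Dw using ew by (intro eq_vecI) (auto simp: ac_simps)
      fix p q assume pq: "p \<cdot>\<^sub>v e + q \<cdot>\<^sub>v w = 0\<^sub>v 6"
      have "(p \<cdot>\<^sub>v e + q \<cdot>\<^sub>v w) $ \<sigma> i = 0" "(p \<cdot>\<^sub>v e + q \<cdot>\<^sub>v w) $ i = 0"
        using i unfolding pq by auto
      then show "p = 0 \<and> q = 0"
        using i nz by (auto simp: e_def w_def)
    qed (use ew in auto)
    then show False using unip[OF D[OF u i, of a]] by blast
  qed
  fix u assume u: "u \<in> U"
  have "u $$ (x, j) = (if x = j then 1 else 0)" if x: "x < 6" and j: "j < 6" for x j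
  proof -
    let ?N = "transv 1 (\<lambda>y. u $$ (y, j))"
    \<comment> \<open>Orthogonality for the commutator, at the basis vector \<open>\<sigma>\<close>
      x. Expanded, the entry is the square of u (x, j), plus 1 if x = j, since u
      (\<open>\<sigma>\<close> j, j) = 0. So the square is known, and in characteristic 2 it
      determines the entry.\<close>
    have "(transv 1 (unit_fun j) * ?N) $$ (x, \<sigma> x) = 0"
      using diag[OF D[OF u j, of 1], of "\<sigma> x"] x by simp
    also have "(transv 1 (unit_fun j) * ?N) $$ (x, \<sigma> x) = ?N $$ (x, \<sigma> x) + unit_fun j x * ?N $$ (\<sigma> j, \<sigma> x)"
      using x j by (simp only: transv_mult_entry sum_unit_\<sigma> transv_carrier \<sigma>_less mult_1_left)
    finally have "u $$ (x, j) * u $$ (x, j) = (if x = j then 1 else 0)"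
      using x j diag[OF u j] \<sigma>_neq[OF x] by (auto simp: transv_entry split: if_splits)
    then show ?thesis by (auto split: if_splits)
  qed
  moreover have "u \<in> carrier_mat 6 6"
    using u U S Sp6_carrier by blast
  ultimately show "u \<in> {1\<^sub>m 6}"
    by (auto intro!: eq_matI)
qed

text \<open>The hypothesis says that \<open>w\<close> lies in one of the two summands.\<close>

lemma transv_Sp42:
  assumes "\<And>i j. i < 6 \<Longrightarrow> j < 6 \<Longrightarrow> (i < 4) \<noteq> (j < 4) \<Longrightarrow> w i * w j = 0"
  shows "transv a w \<in> Sp42"
  using assms by (auto simp: Sp42_def transv_Sp6 commute_proj_iff transv_entry)

lemma reductive_Sp6: "reductive K 6 (\<Phi> ` Sp6)"
  by (rule reductive_\<Phi>[OF matrix_group_Sp6], rule normal_unipotent_trivial[of Sp6])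
    (auto intro: transv_Sp6)

lemma Sp42_subset: "Sp42 \<subseteq> Sp6"
  by (auto simp: Sp42_def)

lemma reductive_Sp42: "reductive K 6 (\<Phi> ` Sp42)"
  by (rule reductive_\<Phi>[OF matrix_group_Sp42], rule normal_unipotent_trivial[OF Sp42_subset])
    (auto intro!: transv_Sp42 split: if_splits)

section \<open>Polynomial equations for both groups\<close>

definition form_eqn :: "nat \<Rightarrow> nat \<Rightarrow> 'a mat \<Rightarrow> 'a" where
  "form_eqn i j A = (\<Sum>l<6. A $$ (l, i) * A $$ (\<sigma> l, j)) + (if j = \<sigma> i then 1 else 0)"

lemma polyfun_form_eqn: "i < 6 \<Longrightarrow> j < 6 \<Longrightarrow> polyfun 6 (form_eqn i j)"
  unfolding form_eqn_def
  by (intro polyfun_add polyfun_sum polyfun_mult polyfun_entry polyfun_const) auto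

lemma ball_params: "(\<forall>f\<in>{g i j | i j. P i j}. Q f) \<longleftrightarrow> (\<forall>i j. P i j \<longrightarrow> Q (g i j))"
  by blast

lemma Sp6_eqns: "A \<in> Sp6 \<longleftrightarrow> A \<in> carrier_mat 6 6 \<and> (\<forall>i j. i < 6 \<and> j < 6 \<longrightarrow> form_eqn i j A = 0)"
  by (auto simp: Sp6_iff form_eqn_def)

lemma closedin_Sp6: "closedin (zariski K 6) (\<Phi> ` Sp6)"
proof -
  have eq: "Sp6 = {A \<in> carrier_mat 6 6. \<forall>f\<in>{form_eqn i j | i j. i < 6 \<and> j < 6}. f A = 0}"
    unfolding ball_params by (auto simp: Sp6_eqns)
  show ?thesis
    unfolding eq by (rule closedin_zariski_polyfuns) (auto intro: polyfun_form_eqn)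
qed

lemma closedin_Sp42: "closedin (zariski K 6) (\<Phi> ` Sp42)"
proof -
  have eq: "Sp42 = {A \<in> carrier_mat 6 6. \<forall>f\<in>{form_eqn i j | i j. i < 6 \<and> j < 6} \<union>
      {\<lambda>A. A $$ (i, j) | i j. i < 6 \<and> j < 6 \<and> (i < 4) \<noteq> (j < 4)}. f A = 0}"
    unfolding ball_Un ball_params Sp42_def Sp6_eqns by (intro Collect_cong) (auto simp: commute_proj_iff)
  show ?thesis
    unfolding eq by (rule closedin_zariski_polyfuns) (auto intro: polyfun_form_eqn polyfun_entry)
qed

end

section \<open>The adjoint action on matrix subspaces\<close>

context field_copy
begin

lemma Ad_\<Phi>:
  assumes "A \<in> carrier_mat n n" "B \<in> carrier_mat n n" "A * B = 1\<^sub>m n" "B * A = 1\<^sub>m n" "N \<in> carrier_mat n n"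
  shows "Ad K n (\<Phi> A) (\<Phi> N) = \<Phi> (A * N * B)"
proof -
  have "A * N \<in> carrier_mat n n" using assms by auto
  then show ?thesis
    using assms by (simp add: Ad_def \<Phi>_inv(2)[OF assms(1-4)])
qed

lemma Ad_submodule_\<Phi>:
  assumes W: "W \<subseteq> carrier_mat n n" "0\<^sub>m n n \<in> W"
    and add: "\<And>A B. A \<in> W \<Longrightarrow> B \<in> W \<Longrightarrow> A + B \<in> W"
    and smult: "\<And>c A. A \<in> W \<Longrightarrow> c \<cdot>\<^sub>m A \<in> W"
    and conj: "\<And>g. g \<in> S \<Longrightarrow> \<exists>h\<in>carrier_mat n n. g * h = 1\<^sub>m n \<and> h * g = 1\<^sub>m n \<and> (\<forall>A\<in>W. g * A * h \<in> W)"
    and S: "S \<subseteq> carrier_mat n n"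
  shows "Ad_submodule K n (\<Phi> ` S) (\<Phi> ` W)"
  unfolding Ad_submodule_def
proof (intro conjI ballI)
  show "submodule (\<Phi> ` W) K (mat_alg K n)"
  proof (rule submodule.intro)
    show "subgroup (\<Phi> ` W) (add_monoid (mat_alg K n))"
    proof
      show "\<Phi> ` W \<subseteq> carrier (add_monoid (mat_alg K n))"
        using W by auto
      show "\<one>\<^bsub>add_monoid (mat_alg K n)\<^esub> \<in> \<Phi> ` W"
        using W by (simp add: zero_mat_alg)
      show "x \<otimes>\<^bsub>add_monoid (mat_alg K n)\<^esub> y \<in> \<Phi> ` W" if "x \<in> \<Phi> ` W" "y \<in> \<Phi> ` W" for x y
      proof -
        from that obtain A B where "x = \<Phi> A" "A \<in> W" "y = \<Phi> B" "B \<in> W" by (elim imageE)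
        moreover from this have "A \<in> carrier_mat n n" "B \<in> carrier_mat n n" using W by blast+
        ultimately show ?thesis using add by simp
      qed
      show "inv\<^bsub>add_monoid (mat_alg K n)\<^esub> x \<in> \<Phi> ` W" if "x \<in> \<Phi> ` W" for x
      proof -
        from that obtain A where A: "x = \<Phi> A" "A \<in> W" by (elim imageE)
        then have c: "A \<in> carrier_mat n n" using W by blast
        have "\<ominus>\<^bsub>mat_alg K n\<^esub> \<Phi> A = \<Phi> (- 1 \<cdot>\<^sub>m A)"
        proof (rule M.minus_equality)
          have "- 1 \<cdot>\<^sub>m A + A = 0\<^sub>m n n" using c by (intro eq_matI) auto
          then show "\<Phi> (- 1 \<cdot>\<^sub>m A) \<oplus>\<^bsub>mat_alg K n\<^esub> \<Phi> A = \<zero>\<^bsub>mat_alg K n\<^esub>"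
            using c by (simp add: zero_mat_alg)
        qed (use c in auto)
        then show ?thesis
          using A smult by (simp add: a_inv_def)
      qed
    qed
    show "submodule_axioms (\<Phi> ` W) K (mat_alg K n)"
    proof
      fix c x assume "c \<in> carrier K" "x \<in> \<Phi> ` W"
      then obtain d A where d: "c = \<phi> d" "x = \<Phi> A" "A \<in> W" by (auto simp: carrier_K)
      then have "A \<in> carrier_mat n n" using W by blast
      with d show "c \<odot>\<^bsub>mat_alg K n\<^esub> x \<in> \<Phi> ` W" using smult by simp
    qed
  qed
  fix m x assume "m \<in> \<Phi> ` S" "x \<in> \<Phi> ` W"
  then obtain g A where g: "m = \<Phi> g" "g \<in> S" "x = \<Phi> A" "A \<in> W" by (elim imageE)
  from conj[OF g(2)] obtain h where h: "h \<in> carrier_mat n n" "g * h = 1\<^sub>m n" "h * g = 1\<^sub>m n"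
    "\<And>A. A \<in> W \<Longrightarrow> g * A * h \<in> W" by blast
  have "g \<in> carrier_mat n n" "A \<in> carrier_mat n n" using g W S by blast+
  then show "Ad K n m x \<in> \<Phi> ` W"
    using Ad_\<Phi>[of g n h A] g h by (simp del: assoc_mult_mat)
qed

end

context char2_copy
begin

subsection \<open>The Lie algebras and the reductive pair\<close>

text \<open>The symplectic Lie algebra in characteristic 2: \<open>N * gram\<close> is symmetric,
  with arbitrary diagonal.\<close>

definition gsp6 :: "'a mat set" where
  "gsp6 = {N \<in> carrier_mat 6 6. \<forall>i<6. \<forall>j<6. N $$ (i, \<sigma> j) = N $$ (j, \<sigma> i)}"

text \<open>The linear term in a of the form equation (p, q) at 1 + a N is N
  (\<open>\<sigma>\<close> p, q) + N (\<open>\<sigma>\<close> q, p).\<close>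

lemma lie_algebra_le_gsp6:
  assumes S: "S \<subseteq> Sp6" and N: "N \<in> carrier_mat 6 6" "\<Phi> N \<in> lie_algebra K 6 (\<Phi> ` S)"
  shows "N \<in> gsp6"
proof -
  have "N $$ (\<sigma> p, q) = N $$ (\<sigma> q, p)" if pq: "p < 6" "q < 6" for p q
  proof -
    let ?c = "\<Sum>l<6. N $$ (l, p) * N $$ (\<sigma> l, q)"
    have ev: "form_eqn p q (1\<^sub>m 6 + a \<cdot>\<^sub>m N) = poly [:0, N $$ (\<sigma> p, q) + N $$ (\<sigma> q, p), ?c:] a" for a
    proof -
      have "(\<Sum>l<6. (1\<^sub>m 6 + a \<cdot>\<^sub>m N) $$ (l, p) * (1\<^sub>m 6 + a \<cdot>\<^sub>m N) $$ (\<sigma> l, q)) =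
        (\<Sum>l<6. (if l = p then 1 else 0) * (if \<sigma> l = q then 1 else 0) +
          a * ((if l = p then 1 else 0) * N $$ (\<sigma> l, q)) +
          a * (N $$ (l, p) * (if l = \<sigma> q then 1 else 0)) + a * a * (N $$ (l, p) * N $$ (\<sigma> l, q)))"
        using pq N(1) by (intro sum.cong refl) (auto simp: algebra_simps \<sigma>_eq_iff)
      also have "\<dots> = (if \<sigma> p = q then 1 else 0) + a * N $$ (\<sigma> p, q) + a * N $$ (\<sigma> q, p) + a * a * ?c"
        using pq by (simp only: sum.distrib sum_delta \<sigma>_less sum_distrib_left[symmetric])
      finally show ?thesis
        by (simp add: form_eqn_def algebra_simps)
    qed
    have "Polynomial.coeff [:0, N $$ (\<sigma> p, q) + N $$ (\<sigma> q, p), ?c:] 1 = 0"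
      by (rule lie_algebra_polyfun[OF N(2,1) polyfun_form_eqn[OF pq] _ _ ev])
        (use S Sp6_carrier pq in \<open>auto simp: Sp6_eqns\<close>)
    then show ?thesis by simp
  qed
  note * = this
  have "N $$ (i, \<sigma> j) = N $$ (j, \<sigma> i)" if "i < 6" "j < 6" for i j
    using *[of "\<sigma> i" "\<sigma> j"] that by simp
  then show ?thesis
    using N(1) by (simp add: gsp6_def)
qed

lemma lie_algebra_entry_zero:
  assumes S: "S \<subseteq> carrier_mat 6 6" "\<And>A. A \<in> S \<Longrightarrow> A $$ (i, j) = 0" and ij: "i < 6" "j < 6" "i \<noteq> j"
    and N: "N \<in> carrier_mat 6 6" "\<Phi> N \<in> lie_algebra K 6 (\<Phi> ` S)"
  shows "N $$ (i, j) = 0"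
proof -
  have "Polynomial.coeff [:0, N $$ (i, j):] 1 = 0"
    by (rule lie_algebra_polyfun[OF N(2,1) polyfun_entry[OF ij(1,2)]]) (use S ij N in auto)
  then show ?thesis by simp
qed

lemma lie_algebra_transv_dir:
  assumes "\<And>a. transv a w \<in> S"
  shows "\<Phi> (transv_dir w) \<in> lie_algebra K 6 (\<Phi> ` S)"
  using assms unfolding transv_def by (intro lie_algebra_line) auto

text \<open>\<open>gsp6\<close> is spanned by the directions of transvections, and a transvection together with its
  scalings is a line inside the group.\<close>

lemma lie_algebra_ge_gsp6:
  assumes tr1: "\<And>a p. p < 6 \<Longrightarrow> transv a (unit_fun p) \<in> S"
    and tr2: "\<And>a p q. p < 6 \<Longrightarrow> q < 6 \<Longrightarrow> R p q \<Longrightarrow> transv a (\<lambda>l. unit_fun p l + unit_fun q l) \<in> S"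
    and N: "N \<in> gsp6" and off: "\<And>p q. p < 6 \<Longrightarrow> q < 6 \<Longrightarrow> \<not> R p q \<Longrightarrow> N $$ (p, \<sigma> q) = 0"
  shows "\<Phi> N \<in> lie_algebra K 6 (\<Phi> ` S)"
proof -
  define D where "D p q = mat 6 6 (\<lambda>(x, y). if x = p \<and> \<sigma> y = q \<or> x = q \<and> \<sigma> y = p then 1 else 0 :: 'a)" for p q
  have D: "\<Phi> (D p q) \<in> lie_algebra K 6 (\<Phi> ` S)" if pq: "p < 6" "q < 6" "R p q \<or> p = q" for p q
  proof (cases "p = q")
    case True
    then have "D p q = transv_dir (unit_fun p)"
      by (intro eq_matI) (auto simp: D_def transv_dir_def)
    then show ?thesis using tr1 pq by (simp add: lie_algebra_transv_dir)
  next
    case False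
    \<comment> \<open>Polarisation: the rank one matrix of e_p + e_q is the sum of those of e_p and
      e_q and the mixed term \<open>D p q\<close>; in characteristic 2, adding the first two again
      removes them.\<close>
    then have eq: "D p q = (transv_dir (\<lambda>l. unit_fun p l + unit_fun q l) + 1 \<cdot>\<^sub>m transv_dir (unit_fun p)) +
        1 \<cdot>\<^sub>m transv_dir (unit_fun q)"
      by (intro eq_matI) (auto simp: D_def transv_dir_def)
    show ?thesis
      unfolding eq using pq False
      by (intro lie_algebra_add_smult lie_algebra_transv_dir tr1 tr2) auto
  qed
  have Nsym: "N $$ (p, \<sigma> q) = N $$ (q, \<sigma> p)" if "p < 6" "q < 6" for p q
    using N that by (simp add: gsp6_def)
  \<comment> \<open>\<open>N\<close> restricted to a set of positions and their mirror images; the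
    induction adds one symmetric pair of positions at a time.\<close>
  define NT where "NT T = mat 6 6 (\<lambda>(x, y). if (x, \<sigma> y) \<in> T \<or> (\<sigma> y, x) \<in> T then N $$ (x, y) else 0)" for T
  have dims: "dim_row (NT T) = 6" "dim_col (NT T) = 6" "dim_row (D p q) = 6" "dim_col (D p q) = 6" for T p q
    by (simp_all add: NT_def D_def)
  have NT: "\<Phi> (NT T) \<in> lie_algebra K 6 (\<Phi> ` S)"
    \<comment> \<open>Only pairs with p \<le> q are listed: a pair met in both orders would be added
      twice and cancel.\<close>
    if "finite T" "T \<subseteq> {(p, q). p \<le> q \<and> q < 6}" for T
    using that
  proof (induction rule: finite_induct)
    case empty
    have "NT {} = 0\<^sub>m 6 6" by (intro eq_matI) (auto simp: NT_def)
    then show ?case by (simp add: lie_algebra_zero)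
  next
    case (insert t T)
    obtain p q where t: "t = (p, q)" "p \<le> q" "q < 6" using insert.prems by auto
    have pq: "p < 6" "q < 6" "(p, q) \<notin> T" "(q, p) \<notin> T"
      using t insert.prems insert.hyps by auto
    have entry: "NT (insert t T) $$ (x, y) = NT T $$ (x, y) + N $$ (p, \<sigma> q) * D p q $$ (x, y)"
      if xy: "x < 6" "y < 6" for x y
    proof -
      consider "x = p" "\<sigma> y = q" | "x = q" "\<sigma> y = p" | "\<not> (x = p \<and> \<sigma> y = q \<or> x = q \<and> \<sigma> y = p)"
        by blast
      then show ?thesis
      proof cases
        case 1
        then have "y = \<sigma> q" using xy by auto
        with 1 show ?thesis using xy pq by (simp add: NT_def D_def t)
      next
        case 2
        then have "y = \<sigma> p" using xy by auto
        with 2 show ?thesis using xy pq Nsym[of p q] by (simp add: NT_def D_def t)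
      next
        case 3
        then have "(x, \<sigma> y) \<noteq> t" "(\<sigma> y, x) \<noteq> t"
          by (auto simp only: t prod.inject)
        moreover have "D p q $$ (x, y) = 0"
          using 3 xy by (simp only: D_def index_mat split_conv if_False)
        ultimately show ?thesis using xy by (simp add: NT_def)
      qed
    qed
    have eq: "NT (insert t T) = NT T + N $$ (p, \<sigma> q) \<cdot>\<^sub>m D p q"
    proof (rule eq_matI)
      fix x y assume "x < dim_row (NT T + N $$ (p, \<sigma> q) \<cdot>\<^sub>m D p q)"
        "y < dim_col (NT T + N $$ (p, \<sigma> q) \<cdot>\<^sub>m D p q)"
      then have "x < 6" "y < 6" by (simp_all add: dims)
      then show "NT (insert t T) $$ (x, y) = (NT T + N $$ (p, \<sigma> q) \<cdot>\<^sub>m D p q) $$ (x, y)"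
        by (simp add: entry dims)
    qed (simp_all add: dims)
    have IH: "\<Phi> (NT T) \<in> lie_algebra K 6 (\<Phi> ` S)"
      using insert by auto
    show ?case
    proof (cases "R p q \<or> p = q")
      case True
      show ?thesis
        unfolding eq using True pq IH
        by (intro lie_algebra_add_smult D) (auto simp: NT_def D_def)
    next
      case False
      then have "NT (insert t T) = NT T"
        unfolding eq using off[of p q] pq by (intro eq_matI) (auto simp: NT_def D_def)
      with IH show ?thesis by simp
    qed
  qed
  have "finite {(p, q). p \<le> q \<and> q < (6::nat)}"
    by (rule finite_subset[of _ "{..6} \<times> {..6}"]) auto
  then have "\<Phi> (NT {(p, q). p \<le> q \<and> q < 6}) \<in> lie_algebra K 6 (\<Phi> ` S)"
    by (rule NT) simp
  moreover have "NT {(p, q). p \<le> q \<and> q < 6} = N"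
    using N by (intro eq_matI) (auto simp: NT_def gsp6_def)
  ultimately show ?thesis by simp
qed

lemma lie_algebra_carrier:
  assumes "x \<in> lie_algebra K n T"
  obtains N where "x = \<Phi> N" "N \<in> carrier_mat n n"
  using assms by (auto simp: lie_algebra_def carrier_mat_alg)

lemma lie_algebra_Sp6: "lie_algebra K 6 (\<Phi> ` Sp6) = \<Phi> ` gsp6"
proof (intro equalityI subsetI)
  fix x assume x: "x \<in> lie_algebra K 6 (\<Phi> ` Sp6)"
  then obtain N where "x = \<Phi> N" "N \<in> carrier_mat 6 6" by (rule lie_algebra_carrier)
  with x show "x \<in> \<Phi> ` gsp6" using lie_algebra_le_gsp6[of Sp6 N] by auto
next
  fix x assume "x \<in> \<Phi> ` gsp6"
  then obtain N where "x = \<Phi> N" "N \<in> gsp6" by (elim imageE)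
  then show "x \<in> lie_algebra K 6 (\<Phi> ` Sp6)"
    using lie_algebra_ge_gsp6[of Sp6 "\<lambda>_ _. True" N] by (simp add: transv_Sp6)
qed

lemma lie_algebra_Sp42: "lie_algebra K 6 (\<Phi> ` Sp42) = \<Phi> ` {N \<in> gsp6. proj * N = N * proj}"
proof (intro equalityI subsetI)
  fix x assume x: "x \<in> lie_algebra K 6 (\<Phi> ` Sp42)"
  then obtain N where N: "x = \<Phi> N" "N \<in> carrier_mat 6 6" by (rule lie_algebra_carrier)
  have "N $$ (i, j) = 0" if ij: "i < 6" "j < 6" "(i < 4) \<noteq> (j < 4)" for i j
  proof (rule lie_algebra_entry_zero[of Sp42])
    show "A $$ (i, j) = 0" if "A \<in> Sp42" for A
      using that ij commute_proj_iff[of A] by (auto simp: Sp42_def Sp6_def)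
  qed (use ij N x Sp42_subset Sp6_carrier in auto)
  then have "proj * N = N * proj" using N by (simp add: commute_proj_iff)
  moreover have "N \<in> gsp6" using lie_algebra_le_gsp6[OF Sp42_subset, of N] N x by simp
  ultimately show "x \<in> \<Phi> ` {N \<in> gsp6. proj * N = N * proj}" using N by simp
next
  fix x assume "x \<in> \<Phi> ` {N \<in> gsp6. proj * N = N * proj}"
  then obtain N where N: "x = \<Phi> N" "N \<in> gsp6" "proj * N = N * proj" by auto
  then have c: "N \<in> carrier_mat 6 6" by (simp add: gsp6_def)
  have "\<Phi> N \<in> lie_algebra K 6 (\<Phi> ` Sp42)"
  \<comment> \<open>The transvection along e_p + e_q is used only when p and q belong to the same
    summand; the other entries of N vanish.\<close>
  proof (rule lie_algebra_ge_gsp6[of Sp42 "\<lambda>p q. (p < 4) = (q < 4)"])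
    show "N $$ (p, \<sigma> q) = 0" if "p < 6" "q < 6" "\<not> (p < 4) = (q < 4)" for p q
      using that N(3) unfolding commute_proj_iff[OF c] by auto
  qed (use N in \<open>auto intro!: transv_Sp42 split: if_splits\<close>)
  then show "x \<in> lie_algebra K 6 (\<Phi> ` Sp42)" using N by simp
qed

lemma gsp6_iff: "N \<in> gsp6 \<longleftrightarrow> N \<in> carrier_mat 6 6 \<and> transpose_mat (N * gram) = N * gram"
proof (cases "N \<in> carrier_mat 6 6")
  case True
  have "transpose_mat (N * gram) = N * gram \<longleftrightarrow> (\<forall>i<6. \<forall>j<6. (N * gram) $$ (j, i) = (N * gram) $$ (i, j))"
    using True by (auto simp: mat_eq_iff gram_def)
  also have "\<dots> \<longleftrightarrow> (\<forall>i<6. \<forall>j<6. N $$ (i, \<sigma> j) = N $$ (j, \<sigma> i))"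
    by (intro all_cong1 imp_cong refl) (auto simp: mult_gram_entry(1)[OF True])
  finally show ?thesis using True by (simp add: gsp6_def)
qed (simp add: gsp6_def)

text \<open>With the inverse of \<open>A\<close> written through \<open>gram\<close>, conjugation of
  \<open>N\<close> becomes the congruence taking N gram to A (N gram) A^T, which preserves
  symmetry.\<close>

lemma gsp6_conj:
  assumes "A \<in> Sp6" "N \<in> gsp6"
  shows "A * N * (gram * transpose_mat A * gram) \<in> gsp6"
proof -
  have c: "A \<in> carrier_mat 6 6" "N \<in> carrier_mat 6 6" using assms by (auto simp: Sp6_def gsp6_def)
  have eq: "A * N * (gram * transpose_mat A * gram) * gram = A * (N * gram) * transpose_mat A"
    using c by (simp add: assoc_6 right_mult_one_mat[of _ 6 6])
  have "transpose_mat (A * (N * gram) * transpose_mat A) = A * transpose_mat (N * gram) * transpose_mat A"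
    using c by (simp add: transpose_mult[of _ 6 6 _ 6] assoc_6)
  with assms c show ?thesis
    unfolding gsp6_iff eq by simp
qed

end

context field_copy
begin

lemma simult_conj_\<Phi>:
  assumes "A \<in> carrier_mat n n" "B \<in> carrier_mat n n" "A * B = 1\<^sub>m n" "B * A = 1\<^sub>m n"
    and "C \<in> carrier_mat n n" "D \<in> carrier_mat n n"
  shows "simult_conj K n (\<Phi> A) (\<Phi> C, \<Phi> D) = (\<Phi> (A * C * B), \<Phi> (A * D * B))"
proof -
  have "A * C \<in> carrier_mat n n" "A * D \<in> carrier_mat n n" using assms by auto
  then show ?thesis
    using assms by (simp add: simult_conj_def GL_simps \<Phi>_inv(3)[OF assms(1-4)] del: assoc_mult_mat)
qed

end

lemma mat_eq_6_iff:
  assumes "A \<in> carrier_mat 6 6" "B \<in> carrier_mat 6 6"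
  shows "A = B \<longleftrightarrow> (\<forall>i<6. \<forall>j<6. A $$ (i, j) = B $$ (i, j))"
  using assms by (auto simp: mat_eq_iff)

lemma all_less_6: "(\<forall>i<6. P i) \<longleftrightarrow> P 0 \<and> P 1 \<and> P 2 \<and> P 3 \<and> P 4 \<and> P (5::nat)"
  unfolding less_6 imp_disjL all_conj_distrib by simp

section \<open>The invariant complement of Lie M, and the two generators\<close>

context char2_copy
begin

text \<open>Membership of the conjugate in \<open>gsp6\<close> comes from \<open>gsp6_conj\<close>,
  so in each application only the condition involving \<open>proj\<close> has to be checked.\<close>

lemma Ad_submodule_Sp42:
  assumes W: "W \<subseteq> gsp6" "0\<^sub>m 6 6 \<in> W"
    and add: "\<And>A B. A \<in> W \<Longrightarrow> B \<in> W \<Longrightarrow> A + B \<in> W"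
    and smult: "\<And>c A. A \<in> W \<Longrightarrow> c \<cdot>\<^sub>m A \<in> W"
    and conj: "\<And>g h A. g \<in> Sp42 \<Longrightarrow> h \<in> Sp42 \<Longrightarrow> A \<in> W \<Longrightarrow> g * A * h \<in> gsp6 \<Longrightarrow> g * A * h \<in> W"
  shows "Ad_submodule K 6 (\<Phi> ` Sp42) (\<Phi> ` W)"
proof (rule Ad_submodule_\<Phi>[OF _ W(2) add smult])
  show "W \<subseteq> carrier_mat 6 6" using W by (auto simp: gsp6_def)
  show "Sp42 \<subseteq> carrier_mat 6 6" using Sp42_subset Sp6_carrier by blast
  fix g :: "'a mat" assume g: "g \<in> Sp42"
  then have gS: "g \<in> Sp6" using Sp42_subset by blast
  obtain h where h: "h \<in> Sp42" "g * h = 1\<^sub>m 6" "h * g = 1\<^sub>m 6"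
    using g matrix_group_Sp42 unfolding matrix_group_def by blast
  let ?h = "gram * transpose_mat g * gram"
  have c: "g \<in> carrier_mat 6 6" "h \<in> carrier_mat 6 6" "?h \<in> carrier_mat 6 6"
    using gS h(1) Sp42_subset Sp6_inverse(3)[OF gS] Sp6_carrier by blast+
  \<comment> \<open>Uniqueness of inverses identifies \<open>h\<close> with the inverse that
    \<open>gsp6_conj\<close> expects.\<close>
  have "h = ?h * g * h"
    unfolding Sp6_inverse(1)[OF gS] using c by (simp only: left_mult_one_mat)
  also have "\<dots> = ?h * (g * h)"
    by (rule assoc_6) (use c in auto)
  also have "\<dots> = ?h"
    unfolding h(2) by (rule right_mult_one_mat[where nr = 6]) (use c in auto)
  finally have "h = ?h" .
  then have "g * A * h \<in> W" if "A \<in> W" for A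
    using conj[OF g h(1) that] gsp6_conj[OF gS, of A] that W by auto
  with h c show "\<exists>h\<in>carrier_mat 6 6. g * h = 1\<^sub>m 6 \<and> h * g = 1\<^sub>m 6 \<and> (\<forall>A\<in>W. g * A * h \<in> W)"
    by blast
qed

text \<open>An identity in \<open>proj\<close>, so that conjugation by matrices commuting with
  \<open>proj\<close> visibly preserves it.\<close>

definition off_block :: "'a mat set" where
  "off_block = {N \<in> gsp6. proj * N + N * proj = N}"

lemma off_block_iff:
  assumes "N \<in> carrier_mat 6 6"
  shows "proj * N + N * proj = N \<longleftrightarrow> (\<forall>i<6. \<forall>j<6. (i < 4) = (j < 4) \<longrightarrow> N $$ (i, j) = 0)"
proof -
  have c: "proj * N \<in> carrier_mat 6 6" "N * proj \<in> carrier_mat 6 6"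
    using assms by simp_all
  have "proj * N + N * proj = N \<longleftrightarrow> (\<forall>i<6. \<forall>j<6. (proj * N) $$ (i, j) + (N * proj) $$ (i, j) = N $$ (i, j))"
    unfolding mat_eq_6_iff[OF add_carrier_mat[OF c(2)] assms]
    by (intro all_cong1 imp_cong refl) (use c in \<open>simp only: index_add_mat carrier_matD\<close>)
  also have "\<dots> \<longleftrightarrow> (\<forall>i<6. \<forall>j<6. (i < 4) = (j < 4) \<longrightarrow> N $$ (i, j) = 0)"
    by (intro all_cong1 imp_cong refl) (auto simp: mult_proj_entry[OF assms])
  finally show ?thesis .
qed

lemma commute_proj_conj:
  assumes "g \<in> Sp42" "h \<in> Sp42" "N \<in> carrier_mat 6 6"
  shows "proj * (g * N * h) = g * (proj * N) * h" "g * N * h * proj = g * (N * proj) * h"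
proof -
  have g: "g \<in> carrier_mat 6 6" "proj * g = g * proj" and h: "h \<in> carrier_mat 6 6" "proj * h = h * proj"
    using assms Sp6_carrier by (auto simp: Sp42_def)
  have "proj * (g * N * h) = (proj * g) * N * h" using g(1) h(1) assms(3) by (simp add: assoc_6)
  then show "proj * (g * N * h) = g * (proj * N) * h" using g h(1) assms(3) by (simp add: assoc_6)
  have "g * N * h * proj = g * N * (h * proj)" using g(1) h(1) assms(3) by (simp add: assoc_6)
  also have "\<dots> = g * N * (proj * h)" by (simp only: h)
  finally show "g * N * h * proj = g * (N * proj) * h" using g(1) h(1) assms(3) by (simp add: assoc_6)
qed

lemma gsp6_linear:
  "0\<^sub>m 6 6 \<in> gsp6" "A \<in> gsp6 \<Longrightarrow> B \<in> gsp6 \<Longrightarrow> A + B \<in> gsp6" "A \<in> gsp6 \<Longrightarrow> c \<cdot>\<^sub>m A \<in> gsp6"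
  by (auto simp: gsp6_def)

lemma gsp6_carrier: "N \<in> gsp6 \<Longrightarrow> N \<in> carrier_mat 6 6"
  by (simp add: gsp6_def)

lemma gsp6_dim [simp]: "N \<in> gsp6 \<Longrightarrow> dim_row N = 6" "N \<in> gsp6 \<Longrightarrow> dim_col N = 6"
  by (auto simp: gsp6_def)

lemma reductive_pair_Sp6_Sp42: "reductive_pair K 6 (\<Phi> ` Sp6) (\<Phi> ` Sp42)"
  unfolding reductive_pair_def lie_algebra_Sp6 lie_algebra_Sp42
proof (intro conjI exI)
  show "Ad_submodule K 6 (\<Phi> ` Sp42) (\<Phi> ` {N \<in> gsp6. proj * N = N * proj})"
  proof (rule Ad_submodule_Sp42)
    fix g h A :: "'a mat" assume "g \<in> Sp42" "h \<in> Sp42" "A \<in> {N \<in> gsp6. proj * N = N * proj}" "g * A * h \<in> gsp6"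
    then show "g * A * h \<in> {N \<in> gsp6. proj * N = N * proj}"
      using commute_proj_conj[of g h A] gsp6_carrier[of A] by auto
  qed (auto simp: gsp6_linear commute_proj_iff gsp6_carrier)
  show "Ad_submodule K 6 (\<Phi> ` Sp42) (\<Phi> ` off_block)"
  proof (rule Ad_submodule_Sp42)
    fix g h A :: "'a mat" assume asm: "g \<in> Sp42" "h \<in> Sp42" "A \<in> off_block" "g * A * h \<in> gsp6"
    then have c: "A \<in> carrier_mat 6 6" "g \<in> carrier_mat 6 6" "h \<in> carrier_mat 6 6"
      using Sp6_carrier gsp6_carrier by (auto simp: Sp42_def off_block_def)
    have "proj * (g * A * h) + g * A * h * proj = g * (proj * A + A * proj) * h"
      unfolding commute_proj_conj[OF asm(1,2) c(1)]
      using c by (simp add: mult_add_distrib_mat[of _ 6 6 _ 6] add_mult_distrib_mat[of _ 6 6 _ _ 6])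
    then show "g * A * h \<in> off_block"
      using asm by (simp add: off_block_def)
  qed (auto simp: off_block_def gsp6_linear off_block_iff gsp6_carrier)
  show "\<Phi> ` {N \<in> gsp6. proj * N = N * proj} <+>\<^bsub>mat_alg K 6\<^esub> \<Phi> ` off_block = \<Phi> ` gsp6"
    unfolding set_add_def'
  proof (intro equalityI subsetI)
    fix x assume "x \<in> (\<Union>h\<in>\<Phi> ` {N \<in> gsp6. proj * N = N * proj}. \<Union>k\<in>\<Phi> ` off_block. {h \<oplus>\<^bsub>mat_alg K 6\<^esub> k})"
    then obtain A B where AB: "A \<in> gsp6" "B \<in> gsp6" "x = \<Phi> A \<oplus>\<^bsub>mat_alg K 6\<^esub> \<Phi> B"
      by (auto simp: off_block_def)
    then have "x = \<Phi> (A + B)" using gsp6_carrier by simp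
    then show "x \<in> \<Phi> ` gsp6" using AB gsp6_linear(2) by blast
  next
    fix x assume "x \<in> \<Phi> ` gsp6"
    then obtain N where N: "x = \<Phi> N" "N \<in> gsp6" by (elim imageE)
    \<comment> \<open>Both parts stay in \<open>gsp6\<close> because \<open>\<sigma>\<close>
      preserves the two blocks: mirror positions are kept or dropped together.\<close>
    define A where "A = mat 6 6 (\<lambda>(i, j). if (i < 4) = (j < 4) then N $$ (i, j) else 0)"
    define B where "B = mat 6 6 (\<lambda>(i, j). if (i < 4) = (j < 4) then 0 else N $$ (i, j))"
    have c: "A \<in> carrier_mat 6 6" "B \<in> carrier_mat 6 6" by (auto simp: A_def B_def)
    have "A \<in> gsp6" "B \<in> gsp6" using N(2) by (auto simp: gsp6_def A_def B_def)
    then have "A \<in> {N \<in> gsp6. proj * N = N * proj}" "B \<in> off_block"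
      using c by (auto simp: commute_proj_iff off_block_def off_block_iff) (auto simp: A_def B_def)
    moreover have "N = A + B"
      using gsp6_carrier[OF N(2)] by (intro eq_matI) (auto simp: A_def B_def)
    then have "x = \<Phi> A \<oplus>\<^bsub>mat_alg K 6\<^esub> \<Phi> B" using c N by simp
    ultimately show "x \<in> (\<Union>h\<in>\<Phi> ` {N \<in> gsp6. proj * N = N * proj}. \<Union>k\<in>\<Phi> ` off_block. {h \<oplus>\<^bsub>mat_alg K 6\<^esub> k})"
      by blast
  qed
  have "N = 0\<^sub>m 6 6" if "N \<in> gsp6" "proj * N = N * proj" "proj * N + N * proj = N" for N
  proof -
    have c: "N \<in> carrier_mat 6 6" using that gsp6_carrier by blast
    then have "N $$ (i, j) = 0" if "i < 6" "j < 6" for i j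
      using that \<open>proj * N = N * proj\<close> \<open>proj * N + N * proj = N\<close>
      by (cases "(i < 4) = (j < 4)") (auto simp: commute_proj_iff off_block_iff)
    then show ?thesis using c by (intro eq_matI) auto
  qed
  then show "\<Phi> ` {N \<in> gsp6. proj * N = N * proj} \<inter> \<Phi> ` off_block = {\<zero>\<^bsub>mat_alg K 6\<^esub>}"
    by (auto simp: off_block_def zero_mat_alg gsp6_linear image_iff) (simp_all add: commute_proj_iff off_block_iff)
qed

section \<open>The conjugacy classes\<close>

text \<open>The pair \<open>(gen1 r, gen2 r)\<close> arises from the matrices with rows \<open>(1, 1), (0, 1)\<close> and
  \<open>(1, 0), (1 + n, 1)\<close> over \<open>R\<close> by the isometry \<open>f \<otimes> 1 \<mapsto> f \<otimes> 1 + r (f \<otimes> n)\<close> from \<open>b\<^sub>0\<close> to \<open>b\<^sub>r\<close>.\<close>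

definition gen1 :: "'a \<Rightarrow> 'a mat" where
  "gen1 r = mat 6 6 (\<lambda>(i, j). if i = j \<or> (i, j) \<in> {(0, 2), (1, 3), (4, 5)} then 1 else if (i, j) = (1, 2) then r else 0)"

definition gen2 :: "'a \<Rightarrow> 'a mat" where
  "gen2 r = mat 6 6 (\<lambda>(i, j). if i = j \<or> (i, j) \<in> {(2, 0), (3, 1), (5, 4)} then 1 else if (i, j) = (3, 0) then 1 + r else 0)"

text \<open>The isometry above for \<open>r = s\<^sup>2\<close>, followed by the \<open>R\<close>-linear map of \<open>R \<oplus> R/n\<close> that sends \<open>(1, 0)\<close>
  to \<open>(1, s)\<close> and \<open>(0, 1)\<close> to \<open>(s n, 1)\<close>.\<close>

definition shear :: "'a \<Rightarrow> 'a mat" where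
  "shear s = mat 6 6 (\<lambda>(i, j). if i = j then 1 else if (i, j) \<in> {(4, 0), (5, 2), (1, 4), (3, 5)} then s
    else if (i, j) = (3, 2) then s * s else 0)"

lemma gen_carrier [simp]: "gen1 r \<in> carrier_mat 6 6" "gen2 r \<in> carrier_mat 6 6" "shear s \<in> carrier_mat 6 6"
  by (simp_all add: gen1_def gen2_def shear_def)

lemma gen1_Sp42: "gen1 r \<in> Sp42"
  unfolding Sp42_def Sp6_iff mem_Collect_eq commute_proj_iff[OF gen_carrier(1)] all_less_6 sum_6
  by (simp add: gen1_def \<sigma>_def)

lemma gen2_Sp42: "gen2 r \<in> Sp42"
  unfolding Sp42_def Sp6_iff mem_Collect_eq commute_proj_iff[OF gen_carrier(2)] all_less_6 sum_6
  by (simp add: gen2_def \<sigma>_def)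

text \<open>The first factor is an isometry from b_0 to b_r with r = s^2. The second leads back to
  b_0, since it sends the generators to orthogonal elements of norms 1 + s^2 n and n.\<close>

lemma shear_Sp6: "shear s \<in> Sp6"
  unfolding Sp6_iff all_less_6 sum_6
  by (simp add: shear_def \<sigma>_def)

lemma mult_mat_entry_6:
  "A \<in> carrier_mat 6 6 \<Longrightarrow> B \<in> carrier_mat 6 6 \<Longrightarrow> i < 6 \<Longrightarrow> j < 6 \<Longrightarrow>
    (A * B) $$ (i, j) = A $$ (i, 0) * B $$ (0, j) + A $$ (i, 1) * B $$ (1, j) + A $$ (i, 2) * B $$ (2, j) +
      A $$ (i, 3) * B $$ (3, j) + A $$ (i, 4) * B $$ (4, j) + A $$ (i, 5) * B $$ (5, j)"
  by (simp only: mult_mat_entry sum_6)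

text \<open>The first factor of \<open>shear s\<close> conjugates \<open>gen1 (s * s)\<close> into
  \<open>gen1 0\<close>; the second is R-linear and hence commutes with \<open>gen1 0\<close>. The
  same holds for \<open>gen2\<close>.\<close>

lemma shear_gen1: "shear s * gen1 (s * s) = gen1 0 * shear s"
proof (rule eq_matI)
  fix i j assume "i < dim_row (gen1 0 * shear s)" "j < dim_col (gen1 0 * shear s)"
  then have "i < 6" "j < 6" by (simp_all add: gen1_def shear_def)
  then show "(shear s * gen1 (s * s)) $$ (i, j) = (gen1 0 * shear s) $$ (i, j)"
    unfolding mult_mat_entry_6[OF gen_carrier(3,1) \<open>i < 6\<close> \<open>j < 6\<close>] mult_mat_entry_6[OF gen_carrier(1,3) \<open>i < 6\<close> \<open>j < 6\<close>]
    unfolding less_6 by (elim disjE) (simp_all add: gen1_def shear_def)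
qed (simp_all add: gen1_def shear_def)

lemma shear_gen2: "shear s * gen2 (s * s) = gen2 0 * shear s"
proof (rule eq_matI)
  fix i j assume "i < dim_row (gen2 0 * shear s)" "j < dim_col (gen2 0 * shear s)"
  then have "i < 6" "j < 6" by (simp_all add: gen2_def shear_def)
  then show "(shear s * gen2 (s * s)) $$ (i, j) = (gen2 0 * shear s) $$ (i, j)"
    unfolding mult_mat_entry_6[OF gen_carrier(3,2) \<open>i < 6\<close> \<open>j < 6\<close>] mult_mat_entry_6[OF gen_carrier(2,3) \<open>i < 6\<close> \<open>j < 6\<close>]
    unfolding less_6 by (elim disjE) (simp_all add: gen2_def shear_def)
qed (simp_all add: gen2_def shear_def)

end

text \<open>Over a finite field, the product of all X - x, plus 1, takes only the value 1.\<close>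

lemma infinite_alg_closed_field: "infinite (UNIV :: 'a::alg_closed_field set)"
proof
  assume fin: "finite (UNIV :: 'a set)"
  define p where "p = (\<Prod>x\<in>(UNIV :: 'a set). [:- x, 1:]) + 1"
  have "Polynomial.degree (\<Prod>x\<in>(UNIV :: 'a set). [:- x, 1:]) = card (UNIV :: 'a set)"
    by (subst degree_prod_eq_sum_degree) auto
  moreover have "card (UNIV :: 'a set) > 0"
    using fin by (simp add: card_gt_0_iff)
  ultimately have "Polynomial.degree p > 0"
    unfolding p_def by (subst degree_add_eq_left) auto
  then obtain y where "poly p y = 0"
    using alg_closed_imp_poly_has_root by blast
  moreover have "poly (\<Prod>x\<in>(UNIV :: 'a set). [:- x, 1:]) y = 0"
    unfolding poly_prod using fin by (intro prod_zero) (auto intro: bexI[of _ y])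
  ultimately show False by (simp add: p_def)
qed

section \<open>Separating the classes under M\<close>

context char2_copy
begin

text \<open>The relations force \<open>c\<close> to act on e (x) R as multiplication by u = c00 +
  c10 n and on f (x) R as multiplication by u' = (1 + (r + r') n) u. Preserving the form means u u'
  = 1. In characteristic 2 the square of u is the square of c00 and has no n-term, so r + r' = 0.
  The proof reads off the entries it needs one by one.\<close>

lemma commuting_gens:
  assumes c: "c \<in> Sp42"
    and g1: "c * gen1 r = gen1 r' * c" and g2: "c * gen2 r = gen2 r' * c"
  shows "r = r'"
proof -
  have cc: "c \<in> carrier_mat 6 6" using c Sp42_subset Sp6_carrier by blast
  have z: "c $$ (i, j) = 0" if "i < 6" "j < 6" "(i < 4) \<noteq> (j < 4)" for i j
    using c that commute_proj_iff[OF cc] by (simp add: Sp42_def)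
  note zs = z[of 0 4] z[of 0 5] z[of 1 4] z[of 1 5] z[of 2 4] z[of 2 5] z[of 3 4] z[of 3 5]
    z[of 4 0] z[of 4 1] z[of 4 2] z[of 4 3] z[of 5 0] z[of 5 1] z[of 5 2] z[of 5 3]
  have e1: "(\<Sum>l<6. c $$ (i, l) * gen1 r $$ (l, j)) = (\<Sum>l<6. gen1 r' $$ (i, l) * c $$ (l, j))"
    if "i < 6" "j < 6" for i j
    using that by (simp only: g1 flip: mult_mat_entry[OF cc gen_carrier(1)] mult_mat_entry[OF gen_carrier(1) cc])
  have e2: "(\<Sum>l<6. c $$ (i, l) * gen2 r $$ (l, j)) = (\<Sum>l<6. gen2 r' $$ (i, l) * c $$ (l, j))"
    if "i < 6" "j < 6" for i j
    using that by (simp only: g2 flip: mult_mat_entry[OF cc gen_carrier(2)] mult_mat_entry[OF gen_carrier(2) cc])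
  have c20: "c $$ (2, 0) = 0" using e1[of 0 0] zs by (simp add: sum_6 gen1_def)
  have c03: "c $$ (0, 3) = 0" using e2[of 0 1] zs by (simp add: sum_6 gen2_def)
  have c13: "c $$ (1, 3) = 0" using e2[of 1 1] zs c03 by (simp add: sum_6 gen2_def)
  have c30: "c $$ (3, 0) = 0" using e1[of 1 0] zs c20 by (simp add: sum_6 gen1_def)
  have c12: "c $$ (1, 2) = 0" using e2[of 1 0] zs c13 by (simp add: sum_6 gen2_def)
  \<comment> \<open>Inserting the first two of these three relations into the third leaves c (0, 1)
    = 0.\<close>
  have "c $$ (0, 1) = c $$ (2, 3)"
    using e1[of 0 3] zs c03 by (simp add: sum_6 gen1_def)
  moreover have "c $$ (1, 1) = r' * c $$ (2, 3) + c $$ (3, 3)"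
    using e1[of 1 3] zs c13 by (simp add: sum_6 gen1_def ac_simps)
  moreover have "c $$ (3, 3) = (1 + r') * c $$ (0, 1) + c $$ (1, 1)"
    using e2[of 3 1] zs by (simp add: sum_6 gen2_def ac_simps)
  ultimately have c01: "c $$ (0, 1) = 0" and c23: "c $$ (2, 3) = 0" and c33: "c $$ (3, 3) = c $$ (1, 1)"
    by (auto simp: algebra_simps)
  have c22: "c $$ (2, 2) = c $$ (0, 0)"
    using e1[of 0 2] zs c01 by (simp add: sum_6 gen1_def ac_simps)
  \<comment> \<open>Adding the two equations cancels everything except u = v; the first one then
    gives p + q.\<close>
  have lin: "u = v \<and> p + q = (x + y) * v" if eqs: "p + x * u = y * v + q" "q + (1 + x) * u = (1 + y) * v + p"
    for p q u v x y :: 'a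
  proof -
    have xu: "x * u = p + (y * v + q)"
      using eqs(1) by (metis add_left_self)
    have "q + (u + (p + (y * v + q))) = v + y * v + p"
      using eqs(2) by (simp only: distrib_right mult_1_left xu)
    then have uv: "u = v"
      by (simp add: ac_simps)
    have "(x + y) * v = p + (y * v + q) + y * v"
      using xu by (simp only: uv distrib_right)
    then show ?thesis
      using uv by (simp add: ac_simps)
  qed
  have "c $$ (1, 0) + r * c $$ (1, 1) = r' * c $$ (0, 0) + c $$ (3, 2)"
    using e1[of 1 2] zs c12 c22 by (simp add: sum_6 gen1_def ac_simps)
  moreover have "c $$ (3, 2) + (1 + r) * c $$ (1, 1) = (1 + r') * c $$ (0, 0) + c $$ (1, 0)"
    using e2[of 3 0] zs c30 c33 by (simp add: sum_6 gen2_def ac_simps)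
  ultimately have c11: "c $$ (1, 1) = c $$ (0, 0)"
    and rr: "c $$ (1, 0) + c $$ (3, 2) = (r + r') * c $$ (0, 0)"
    using lin by blast+
  have form: "(\<Sum>l<6. c $$ (l, i) * c $$ (\<sigma> l, j)) = (if j = \<sigma> i then 1 else 0)" if "i < 6" "j < 6" for i j
    using c Sp42_subset that by (auto simp: Sp6_iff)
  have a: "c $$ (0, 0) = 1"
    using form[of 0 3] zs c20 c30 c13 c03 c23 c33 c11 by (simp add: sum_6 \<sigma>_def)
  \<comment> \<open>The n-term of u u' = 1, as the pairing of the images of e (x) 1 and f (x)
    1.\<close>
  have "c $$ (3, 2) + c $$ (1, 0) = 0"
    using form[of 0 2] zs c20 c30 c12 c22 a by (simp add: sum_6 \<sigma>_def)
  with rr a show ?thesis by (simp add: ac_simps)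
qed

definition gen_pair :: "'a \<Rightarrow> 'b mat \<times> 'b mat" where
  "gen_pair r = (\<Phi> (gen1 r), \<Phi> (gen2 r))"

lemma gen_pair_orbit: "gen_pair (s * s) \<in> pair_orbit K 6 (\<Phi> ` Sp6) (gen_pair 0)"
proof -
  \<comment> \<open>\<open>shear s\<close> intertwines the pair of s * s with the pair of 0, so its
    inverse is the conjugating element.\<close>
  obtain h where h: "h \<in> Sp6" "shear s * h = 1\<^sub>m 6" "h * shear s = 1\<^sub>m 6"
    using matrix_group_Sp6 shear_Sp6 unfolding matrix_group_def by blast
  have c: "h \<in> carrier_mat 6 6" using h Sp6_carrier by blast
  have conj: "h * A * shear s = B"
    if "shear s * B = A * shear s" "A \<in> carrier_mat 6 6" "B \<in> carrier_mat 6 6" for A B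
  proof -
    have "h * A * shear s = h * (shear s * B)" using c that by (simp add: assoc_6)
    also have "\<dots> = h * shear s * B" using c that(3) by (simp add: assoc_6)
    also have "\<dots> = B" using that(3) by (simp only: h(3) left_mult_one_mat)
    finally show ?thesis .
  qed
  have "simult_conj K 6 (\<Phi> h) (gen_pair 0) = gen_pair (s * s)"
    unfolding gen_pair_def simult_conj_\<Phi>[OF c gen_carrier(3) h(3,2) gen_carrier(1,2)]
    by (simp only: conj[OF shear_gen1 gen_carrier(1) gen_carrier(1)] conj[OF shear_gen2 gen_carrier(2) gen_carrier(2)])
  with h(1) show ?thesis
    unfolding pair_orbit_def orbit_def by force
qed

lemma gen_pair_inequivalent:
  assumes "C \<in> pair_classes K 6 (\<Phi> ` Sp42)" "gen_pair r \<in> C" "gen_pair r' \<in> C"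
  shows "r = r'"
proof -
  obtain x where x: "x \<in> \<Phi> ` Sp42 \<times> \<Phi> ` Sp42" and C: "C = {simult_conj K 6 g x | g. g \<in> \<Phi> ` Sp42}"
    using assms(1) by (auto simp: pair_classes_def orbits_def orbit_def)
  obtain A B where AB: "x = (\<Phi> A, \<Phi> B)" "A \<in> Sp42" "B \<in> Sp42"
    using x by auto
  have carr: "A \<in> carrier_mat 6 6" if "A \<in> Sp42" for A :: "'a mat"
    using that Sp42_subset Sp6_carrier by blast
  have ex: "\<exists>g\<in>Sp42. \<exists>h\<in>Sp42. g * h = 1\<^sub>m 6 \<and> h * g = 1\<^sub>m 6 \<and> gen1 t = g * A * h \<and> gen2 t = g * B * h"
    if t: "gen_pair t \<in> C" for t
  proof -
    obtain g where g: "g \<in> Sp42" "gen_pair t = simult_conj K 6 (\<Phi> g) (\<Phi> A, \<Phi> B)"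
      using t unfolding C AB(1) by blast
    obtain h where h: "h \<in> Sp42" "g * h = 1\<^sub>m 6" "h * g = 1\<^sub>m 6"
      using g(1) matrix_group_Sp42 unfolding matrix_group_def by blast
    have "gen1 t = g * A * h \<and> gen2 t = g * B * h"
      using g(2) simult_conj_\<Phi>[of g 6 h A B] carr AB g(1) h by (simp add: gen_pair_def)
    with g h show ?thesis by blast
  qed
  from ex[OF assms(2)] obtain g h where g: "g \<in> Sp42" "h \<in> Sp42" "g * h = 1\<^sub>m 6" "h * g = 1\<^sub>m 6"
    "gen1 r = g * A * h" "gen2 r = g * B * h" by blast
  from ex[OF assms(3)] obtain g' h' where g': "g' \<in> Sp42" "h' \<in> Sp42" "g' * h' = 1\<^sub>m 6" "h' * g' = 1\<^sub>m 6"
    "gen1 r' = g' * A * h'" "gen2 r' = g' * B * h'" by blast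
  \<comment> \<open>\<open>h\<close> is the inverse of \<open>g\<close>: going back to the base
    point of the orbit with \<open>h\<close> and on with \<open>g'\<close> carries the pair of r to
    the pair of r'.\<close>
  have comm: "g' * h * (g * D * h) = g' * D * h' * (g' * h)" if D: "D \<in> carrier_mat 6 6" for D
  proof -
    note cs = carr[OF g(1)] carr[OF g(2)] carr[OF g'(1)] carr[OF g'(2)] D
    have "g' * h * (g * D * h) = g' * (h * g) * (D * h)" using cs by (simp add: assoc_6)
    also have "\<dots> = g' * D * h"
      unfolding g(4) using cs by (simp add: assoc_6 left_mult_one_mat[of _ 6 6])
    also have "\<dots> = g' * D * (h' * g') * h"
      unfolding g'(4) using cs by (simp add: assoc_6 left_mult_one_mat[of _ 6 6])
    also have "\<dots> = g' * D * h' * (g' * h)" using cs by (simp add: assoc_6)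
    finally show ?thesis .
  qed
  have "g' * h \<in> Sp42"
    using g g' matrix_group_Sp42 unfolding matrix_group_def by blast
  then show ?thesis
    by (rule commuting_gens) (simp_all only: g g' comm[OF carr[OF AB(2)]] comm[OF carr[OF AB(3)]])
qed

lemma infinitely_many_classes:
  "\<not> (\<exists>\<C>. finite \<C> \<and> \<C> \<subseteq> pair_classes K 6 (\<Phi> ` Sp42) \<and>
    pair_orbit K 6 (\<Phi> ` Sp6) (gen_pair 0) \<inter> (\<Phi> ` Sp42 \<times> \<Phi> ` Sp42) = \<Union>\<C>)"
proof
  assume "\<exists>\<C>. finite \<C> \<and> \<C> \<subseteq> pair_classes K 6 (\<Phi> ` Sp42) \<and>
    pair_orbit K 6 (\<Phi> ` Sp6) (gen_pair 0) \<inter> (\<Phi> ` Sp42 \<times> \<Phi> ` Sp42) = \<Union>\<C>"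
  then obtain \<C> where C: "finite \<C>" "\<C> \<subseteq> pair_classes K 6 (\<Phi> ` Sp42)"
    "pair_orbit K 6 (\<Phi> ` Sp6) (gen_pair 0) \<inter> (\<Phi> ` Sp42 \<times> \<Phi> ` Sp42) = \<Union>\<C>" by blast
  have "\<exists>c\<in>\<C>. gen_pair (s * s) \<in> c" for s
  proof -
    have "gen_pair (s * s) \<in> \<Union>\<C>"
      unfolding C(3)[symmetric] using gen_pair_orbit by (auto simp: gen_pair_def gen1_Sp42 gen2_Sp42)
    then show ?thesis by blast
  qed
  then obtain f where f: "\<And>s. f s \<in> \<C>" "\<And>s. gen_pair (s * s) \<in> f s" by metis
  have "inj f"
  proof
    fix s t assume "f s = f t"
    then have "s * s = t * t"
      using gen_pair_inequivalent[of "f s" "s * s" "t * t"] f[of s] f[of t] C(2) by auto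
    \<comment> \<open>Squaring is injective in characteristic 2, so distinct s give distinct
      classes.\<close>
    then have "(s + t) * (s + t) = 0" by (simp add: algebra_simps)
    then show "s = t" by simp
  qed
  moreover have "finite (range f)"
    using f(1) C(1) by (meson finite_subset image_subsetI)
  ultimately show False
    using infinite_field finite_imageD by blast
qed

end

theorem theorem1p5:
  shows "\<exists>(k :: nat set ring) (n :: nat) G M m\<^sub>1 m\<^sub>2.
    algebraically_closed k \<and>
    linear_algebraic_group k n G \<and> reductive k n G \<and>
    closed_subgroup k n M G \<and> reductive k n M \<and>
    (m\<^sub>1, m\<^sub>2) \<in> M \<times> M \<and>
    reductive_pair k n G M \<and>
    \<not> (\<exists>\<C>. finite \<C> \<and> \<C> \<subseteq> pair_classes k n M \<and>
          pair_orbit k n G (m\<^sub>1, m\<^sub>2) \<inter> (M \<times> M) = \<Union>\<C>)"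
proof -
  obtain \<phi> :: "bit alg_closure \<Rightarrow> nat set" where \<phi>: "inj \<phi>"
    using inj_alg_closure_bit by blast
  interpret char2_copy \<phi>
    by unfold_locales (use \<phi> infinite_alg_closed_field two_alg_closure_bit in auto)
  show ?thesis
  proof (intro exI conjI)
    show "algebraically_closed K" using \<phi> by (rule algebraically_closed_copy_ring)
    show "linear_algebraic_group K 6 (\<Phi> ` Sp6)"
      using matrix_group_Sp6 closedin_Sp6 by (rule linear_algebraic_group_\<Phi>)
    show "closed_subgroup K 6 (\<Phi> ` Sp42) (\<Phi> ` Sp6)"
      using matrix_group_Sp42 matrix_group_Sp6 Sp42_subset closedin_Sp42 by (rule closed_subgroup_\<Phi>)
    show "(\<Phi> (gen1 0), \<Phi> (gen2 0)) \<in> \<Phi> ` Sp42 \<times> \<Phi> ` Sp42"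
      by (simp add: gen1_Sp42 gen2_Sp42)
    show "\<not> (\<exists>\<C>. finite \<C> \<and> \<C> \<subseteq> pair_classes K 6 (\<Phi> ` Sp42) \<and>
        pair_orbit K 6 (\<Phi> ` Sp6) (\<Phi> (gen1 0), \<Phi> (gen2 0)) \<inter> (\<Phi> ` Sp42 \<times> \<Phi> ` Sp42) = \<Union>\<C>)"
      using infinitely_many_classes unfolding gen_pair_def .
  qed (rule reductive_Sp6 reductive_Sp42 reductive_pair_Sp6_Sp42)+
qed

end
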